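(* Let $k$ be a field and let $(R,<)$ be a totally ordered set which has a countable subset that is dense in the order topology on $R$. Let $V$ be a pointwise finite-dimensional persistence module over $k$ indexed by $R$. Then $V$ is (isomorphic to) a direct sum of interval modules.
   Context: A persistence module $V$ (over $k$, indexed by $R$) is a functor from $R$, viewed as a category via its order, to $k$-vector spaces: it consists of $k$-vector spaces $V_t$ for $t\in R$ and linear maps $\rho_{ts}:V_s\to V_t$ for $s\le t$, with $\rho_{ts}\rho_{sr}=\rho_{tr}$ for all $r\le s\le t$ and $\rho_{tt}=1_{V_t}$ for all $t$. Morphisms are natural transformations; direct sums are pointwise. $V$ is pointwise finite-dimensional if all $V_t$ are finite-dimensional. A subset $I\subseteq R$ is an interval if it is non-empty and $r\le s\le t$ with $r,t\in I$ implies $s\in I$. The interval module $k_I$ is the persistence module with $V_t=k$ for $t\in I$, $V_t=0$ for $t\notin I$, and $\rho_{ts}=1$ for $s,t\in I$ with $s\le t$ (all other $\rho_{ts}$ being zero). *)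

theory Defs
  imports "HOL-Analysis.Elementary_Topology" "Jordan_Normal_Form.Missing_VectorSpace"
begin

text \<open>
  Vector spaces are those of the AFP entry VectorSpace (locales \<open>vectorspace\<close>, \<open>linear_map\<close> over a
  HOL-Algebra field). Every \<open>fibre V t\<close> is a vector space in its own right, with its own carrier and
  operations. \<open>tmap V t s\<close> is the structure map from \<open>fibre V s\<close> to \<open>fibre V t\<close>; its values for
  arguments outside \<open>s \<le> t\<close> or outside the carrier are irrelevant.
\<close>

record ('r, 'a, 'v) pers_mod =
  fibre :: "'r \<Rightarrow> ('a, 'v) module"
  tmap :: "'r \<Rightarrow> 'r \<Rightarrow> 'v \<Rightarrow> 'v"

locale persistence_module =
  fixes K :: "('a, 'm) ring_scheme" and V :: "('r::linorder, 'a, 'v) pers_mod"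
  assumes fibre_vs: "vectorspace K (fibre V t)"
    and tmap_linear: "s \<le> t \<Longrightarrow> linear_map K (fibre V s) (fibre V t) (tmap V t s)"
    and tmap_comp: "\<lbrakk>r \<le> s; s \<le> t; x \<in> carrier (fibre V r)\<rbrakk>
      \<Longrightarrow> tmap V t s (tmap V s r x) = tmap V t r x"
    and tmap_id: "x \<in> carrier (fibre V t) \<Longrightarrow> tmap V t t x = x"

locale pfd_persistence_module = persistence_module +
  assumes pointwise_fin_dim: "vectorspace.fin_dim K (fibre V t)"

definition pers_morphism ::
  "('a, 'm) ring_scheme \<Rightarrow> ('r::linorder, 'a, 'v) pers_mod \<Rightarrow> ('r, 'a, 'w) pers_mod
    \<Rightarrow> ('r \<Rightarrow> 'v \<Rightarrow> 'w) \<Rightarrow> bool"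
  where "pers_morphism K V W \<phi> \<longleftrightarrow>
    (\<forall>t. linear_map K (fibre V t) (fibre W t) (\<phi> t)) \<and>
    (\<forall>s t. s \<le> t \<longrightarrow> (\<forall>x\<in>carrier (fibre V s). \<phi> t (tmap V t s x) = tmap W t s (\<phi> s x)))"

definition pers_isomorphic ::
  "('a, 'm) ring_scheme \<Rightarrow> ('r::linorder, 'a, 'v) pers_mod \<Rightarrow> ('r, 'a, 'w) pers_mod \<Rightarrow> bool"
  where "pers_isomorphic K V W \<longleftrightarrow>
    (\<exists>\<phi> \<psi>. pers_morphism K V W \<phi> \<and> pers_morphism K W V \<psi> \<and>
      (\<forall>t. \<forall>x\<in>carrier (fibre V t). \<psi> t (\<phi> t x) = x) \<and>
      (\<forall>t. \<forall>y\<in>carrier (fibre W t). \<phi> t (\<psi> t y) = y))"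

definition order_interval :: "'r::linorder set \<Rightarrow> bool"
  where "order_interval I \<longleftrightarrow>
    I \<noteq> {} \<and> (\<forall>r s t. r \<in> I \<and> t \<in> I \<and> r \<le> s \<and> s \<le> t \<longrightarrow> s \<in> I)"

definition interval_module ::
  "('a, 'm) ring_scheme \<Rightarrow> 'r::linorder set \<Rightarrow> ('r, 'a, 'a) pers_mod"
  where "interval_module K I =
    \<lparr>fibre = \<lambda>t.
       \<lparr>carrier = (if t \<in> I then carrier K else {\<zero>\<^bsub>K\<^esub>}),
        mult = mult K, one = one K, zero = zero K, add = add K, smult = mult K\<rparr>,
     tmap = \<lambda>t s x. if s \<in> I \<and> t \<in> I then x else \<zero>\<^bsub>K\<^esub>\<rparr>"

text \<open>
  The external direct sum of modules: families of finite support. The fields \<open>mult\<close> and \<open>one\<close>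
  are present in the record type \<open>module\<close> but play no role for modules.
\<close>

definition direct_sum_mod :: "'i set \<Rightarrow> ('i \<Rightarrow> ('a, 'v) module) \<Rightarrow> ('a, 'i \<Rightarrow> 'v) module"
  where "direct_sum_mod J M =
    \<lparr>carrier = {f \<in> (\<Pi>\<^sub>E j\<in>J. carrier (M j)). finite {j \<in> J. f j \<noteq> \<zero>\<^bsub>M j\<^esub>}},
     mult = undefined, one = undefined,
     zero = (\<lambda>j\<in>J. \<zero>\<^bsub>M j\<^esub>),
     add = (\<lambda>f g. \<lambda>j\<in>J. f j \<oplus>\<^bsub>M j\<^esub> g j),
     smult = (\<lambda>a f. \<lambda>j\<in>J. a \<odot>\<^bsub>M j\<^esub> f j)\<rparr>"

definition pers_direct_sum ::
  "'i set \<Rightarrow> ('i \<Rightarrow> ('r::linorder, 'a, 'v) pers_mod) \<Rightarrow> ('r, 'a, 'i \<Rightarrow> 'v) pers_mod"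
  where "pers_direct_sum J M =
    \<lparr>fibre = \<lambda>t. direct_sum_mod J (\<lambda>j. fibre (M j) t),
     tmap = \<lambda>t s f. \<lambda>j\<in>J. tmap (M j) t s (f j)\<rparr>"

lemma persistence_module_interval_module:
  assumes "field K" and I: "order_interval I"
  shows "persistence_module K (interval_module K I)"
proof -
  interpret field K by fact
  have vs: "vectorspace K (fibre (interval_module K I) t)" for t
    by (rule vs_criteria)
      (auto simp: interval_module_def \<open>field K\<close> a_assoc m_assoc l_distr r_distr r_neg
        split: if_splits intro: a_comm intro!: bexI[of _ "\<ominus>\<^bsub>K\<^esub> v" for v])
  have lin: "linear_map K (fibre (interval_module K I) s) (fibre (interval_module K I) t)
      (tmap (interval_module K I) t s)" for s t
  proof -
    have "mod_hom_axioms K (fibre (interval_module K I) s) (fibre (interval_module K I) t)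
      (tmap (interval_module K I) t s)"
      by (auto simp: mod_hom_axioms_def module_hom_def interval_module_def split: if_splits)
    with vs show ?thesis
      by (auto simp: linear_map_def mod_hom_def vectorspace_def)
  qed
  show ?thesis
  proof (rule persistence_module.intro)
    fix r s t x
    assume "r \<le> s" "s \<le> t" "x \<in> carrier (fibre (interval_module K I) r)"
    moreover from this I have "s \<in> I" if "r \<in> I" "t \<in> I"
      using that unfolding order_interval_def by blast
    ultimately show "tmap (interval_module K I) t s (tmap (interval_module K I) s r x)
        = tmap (interval_module K I) t r x"
      by (cases "r \<in> I"; cases "s \<in> I"; cases "t \<in> I") (simp_all add: interval_module_def)
  next
    fix t x
    assume "x \<in> carrier (fibre (interval_module K I) t)"
    then show "tmap (interval_module K I) t t x = x"
      by (simp add: interval_module_def split: if_splits)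
  qed (rule vs, rule lin)
qed

lemma vectorspace_direct_sum_mod:
  assumes K: "field K" and M: "\<And>j. j \<in> J \<Longrightarrow> vectorspace K (M j)"
  shows "vectorspace K (direct_sum_mod J M)"
proof -
  have md: "module K (M j)" if "j \<in> J" for j
    using M[OF that] by (simp add: vectorspace_def)
  have ab: "abelian_group (M j)" if "j \<in> J" for j
    using md[OF that] by (simp add: module_def)
  note rules = abelian_monoid.a_closed[OF abelian_group.axioms(1)[OF ab]]
    abelian_monoid.zero_closed[OF abelian_group.axioms(1)[OF ab]]
    abelian_monoid.r_zero[OF abelian_group.axioms(1)[OF ab]]
    abelian_monoid.l_zero[OF abelian_group.axioms(1)[OF ab]]
    abelian_group.a_inv_closed[OF ab] abelian_group.r_neg[OF ab]
    module.smult_closed[OF md]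
    module.rmult_0[OF md]
  note a_comm = abelian_monoid.a_comm[OF abelian_group.axioms(1)[OF ab]]
  note a_assoc = abelian_monoid.a_assoc[OF abelian_group.axioms(1)[OF ab]]
  let ?S = "direct_sum_mod J M"
  let ?supp = "\<lambda>f. {j \<in> J. f j \<noteq> \<zero>\<^bsub>M j\<^esub>}"
  have fin_add: "finite {j \<in> J. f j \<oplus>\<^bsub>M j\<^esub> g j \<noteq> \<zero>\<^bsub>M j\<^esub>}"
    if "finite (?supp f)" "finite (?supp g)" for f g
    by (rule finite_subset[OF _ finite_UnI[OF that]]) (auto simp: rules)
  have fin_smult: "finite {j \<in> J. a \<odot>\<^bsub>M j\<^esub> f j \<noteq> \<zero>\<^bsub>M j\<^esub>}"
    if "finite (?supp f)" "a \<in> carrier K" for f a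
    by (rule finite_subset[OF _ that(1)]) (use that(2) in \<open>auto simp: rules\<close>)
  have neg: "\<exists>g\<in>carrier ?S. f \<oplus>\<^bsub>?S\<^esub> g = \<zero>\<^bsub>?S\<^esub>" if f: "f \<in> carrier ?S" for f
  proof
    have a_inv_zero: "\<ominus>\<^bsub>M j\<^esub> \<zero>\<^bsub>M j\<^esub> = \<zero>\<^bsub>M j\<^esub>" if "j \<in> J" for j
      using abelian_group.minus_equality[OF ab[OF that]] that by (simp add: rules)
    let ?g = "\<lambda>j\<in>J. \<ominus>\<^bsub>M j\<^esub> f j"
    have "finite (?supp f)"
      using f by (simp add: direct_sum_mod_def)
    then have "finite {j \<in> J. \<ominus>\<^bsub>M j\<^esub> f j \<noteq> \<zero>\<^bsub>M j\<^esub>}"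
      by (rule rev_finite_subset) (auto simp: a_inv_zero)
    with f show "?g \<in> carrier ?S"
      by (auto simp: direct_sum_mod_def rules PiE_iff cong: conj_cong)
    show "f \<oplus>\<^bsub>?S\<^esub> ?g = \<zero>\<^bsub>?S\<^esub>"
      using f by (auto simp: direct_sum_mod_def rules PiE_iff intro!: restrict_ext)
  qed
  show ?thesis
    apply (rule vs_criteria[OF K])
    subgoal by (simp add: direct_sum_mod_def rules PiE_iff cong: conj_cong)
    subgoal by (auto simp: direct_sum_mod_def rules PiE_iff fin_add cong: conj_cong)
    subgoal using neg by blast
    subgoal by (auto simp: direct_sum_mod_def rules PiE_iff fin_smult cong: conj_cong)
    subgoal by (auto simp: direct_sum_mod_def a_comm PiE_iff intro!: restrict_ext)
    subgoal by (auto simp: direct_sum_mod_def a_assoc PiE_iff intro!: restrict_ext)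
    subgoal by (auto simp: direct_sum_mod_def rules PiE_iff extensional_def)
    subgoal by (auto simp: direct_sum_mod_def module.smult_assoc1[OF md] PiE_iff intro!: restrict_ext)
    subgoal by (auto simp: direct_sum_mod_def module.smult_one[OF md] PiE_iff extensional_def)
    subgoal by (auto simp: direct_sum_mod_def module.smult_l_distr[OF md] PiE_iff intro!: restrict_ext)
    subgoal by (auto simp: direct_sum_mod_def module.smult_r_distr[OF md] PiE_iff intro!: restrict_ext)
    done
qed

lemma persistence_module_pers_direct_sum:
  assumes K: "field K" and M: "\<And>j. j \<in> J \<Longrightarrow> persistence_module K (M j)"
  shows "persistence_module K (pers_direct_sum J M)"
proof -
  let ?S = "pers_direct_sum J M"
  have vs: "vectorspace K (fibre ?S t)" for t
    using M by (auto simp: pers_direct_sum_def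
      intro!: vectorspace_direct_sum_mod[OF K] persistence_module.fibre_vs)
  have lin: "linear_map K (fibre ?S s) (fibre ?S t) (tmap ?S t s)" if "s \<le> t" for s t
  proof -
    have hom: "mod_hom K (fibre (M j) s) (fibre (M j) t) (tmap (M j) t s)" if "j \<in> J" for j
      using persistence_module.tmap_linear[OF M[OF that] \<open>s \<le> t\<close>] by (simp add: linear_map_def)
    note mh = module_hom_closed[OF mod_hom.f_hom[OF hom], THEN funcset_mem]
      module_hom_add[OF mod_hom.f_hom[OF hom]] module_hom_smult[OF mod_hom.f_hom[OF hom]]
      mod_hom.f0_is_0[OF hom]
    have fin: "finite {j \<in> J. tmap (M j) t s (f j) \<noteq> \<zero>\<^bsub>fibre (M j) t\<^esub>}"
      if "finite {j \<in> J. f j \<noteq> \<zero>\<^bsub>fibre (M j) s\<^esub>}" for f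
      by (rule finite_subset[OF _ that]) (auto simp: mh)
    have "mod_hom_axioms K (fibre ?S s) (fibre ?S t) (tmap ?S t s)"
      by (auto simp: mod_hom_axioms_def module_hom_def pers_direct_sum_def direct_sum_mod_def
        PiE_iff mh fin cong: conj_cong)
    with vs show ?thesis
      by (auto simp: linear_map_def mod_hom_def vectorspace_def)
  qed
  have "tmap ?S t s (tmap ?S s r x) = tmap ?S t r x"
    if "r \<le> s" "s \<le> t" "x \<in> carrier (fibre ?S r)" for r s t x
    using that persistence_module.tmap_comp[OF M]
    by (auto simp: pers_direct_sum_def direct_sum_mod_def PiE_iff)
  moreover have "tmap ?S t t x = x" if "x \<in> carrier (fibre ?S t)" for t x
    using that persistence_module.tmap_id[OF M]
    by (auto simp: pers_direct_sum_def direct_sum_mod_def PiE_iff extensional_def)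
  ultimately show ?thesis
    using vs lin by (intro persistence_module.intro) auto
qed

end

theory Submission
  imports Defs
begin

text \<open>
  The decomposition is built from interval summands, one at a time.

  The main point is that a nonzero fibre at \<open>t\<close> always gives an interval summand through \<open>t\<close>
  (\<open>exists_split_bar\<close>). Choose a nonzero vector \<open>e\<close> in the smallest nonzero image of a map into the
  fibre at \<open>t\<close>. The interval \<open>I\<close> consists of the indices below \<open>t\<close> from which some vector survives to
  \<open>t\<close>, and of those above \<open>t\<close> at which \<open>e\<close> is still nonzero. To embed the interval module of \<open>I\<close>, the
  vector \<open>e\<close> must be lifted compatibly to all indices of \<open>I\<close> below \<open>t\<close>. The possible lifts form an
  inverse system of nonempty finite-dimensional affine spaces, and such a system has a nonempty limit
  (\<open>compatible_choice\<close>): descending chains of affine subspaces become stationary, so a minimal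
  subsystem exists by Zorn's lemma, and its members are points. To split the embedding, one needs
  compatible functionals on the fibres over \<open>I\<close> with value 1 on the chosen vectors. Above \<open>t\<close> these
  amount to one functional on a direct limit, obtained from a maximal compatible family of subspaces
  that avoid the images of \<open>e\<close> (\<open>compatible_functionals\<close>); below \<open>t\<close> the functional at \<open>t\<close> is
  composed with the structure maps. It vanishes on everything that comes from below \<open>I\<close>, because
  such vectors are zero at \<open>t\<close>.

  A summand is recorded by its vectors and its functionals. A family of summands is independent when
  these are biorthogonal, which is a condition on pairs, so there is a maximal biorthogonal family by
  Zorn's lemma. Only finitely many of its members live at any given index, so the projection onto
  the common kernel of its functionals is a well-defined natural idempotent. Were this common kernel
  nonzero, it would contain an interval summand of its own, and the projection would turn that into a
  summand of \<open>V\<close> with which the family could be extended (\<open>biorthogonal_extend\<close>). So the common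
  kernel is zero, and the functionals of the family are the coordinates of an isomorphism onto a direct
  sum of interval modules (\<open>interval_decomposition\<close>).
\<close>

section \<open>Descending chains of subspaces and affine subsets\<close>

lemma Zorn_maximal:
  fixes A :: "'b::order set"
  assumes "\<And>C. \<lbrakk>C \<subseteq> A; C \<noteq> {}; \<And>x y. \<lbrakk>x \<in> C; y \<in> C\<rbrakk> \<Longrightarrow> x \<le> y \<or> y \<le> x\<rbrakk> \<Longrightarrow> \<exists>u\<in>A. \<forall>x\<in>C. x \<le> u"
    and "A \<noteq> {}"
  shows "\<exists>m\<in>A. \<forall>x\<in>A. m \<le> x \<longrightarrow> x = m"
proof (rule predicate_Zorn)
  show "partial_order_on A (relation_of (\<le>) A)"
    by (rule partial_order_on_relation_ofI) auto
  fix C assume C: "C \<in> Chains (relation_of (\<le>) A)"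
  show "\<exists>u\<in>A. \<forall>a\<in>C. a \<le> u"
  proof (cases "C = {}")
    case False
    with C show ?thesis
      by (intro assms(1)) (auto simp: Chains_def relation_of_def)
  qed (use \<open>A \<noteq> {}\<close> in auto)
qed

lemma Zorn_minimal:
  fixes A :: "'b::order set"
  assumes "\<And>C. \<lbrakk>C \<subseteq> A; C \<noteq> {}; \<And>x y. \<lbrakk>x \<in> C; y \<in> C\<rbrakk> \<Longrightarrow> x \<le> y \<or> y \<le> x\<rbrakk> \<Longrightarrow> \<exists>u\<in>A. \<forall>x\<in>C. u \<le> x"
    and "A \<noteq> {}"
  shows "\<exists>m\<in>A. \<forall>x\<in>A. x \<le> m \<longrightarrow> x = m"
proof (rule predicate_Zorn)
  show "partial_order_on A (relation_of (\<ge>) A)"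
    by (rule partial_order_on_relation_ofI) auto
  fix C assume C: "C \<in> Chains (relation_of (\<ge>) A)"
  show "\<exists>u\<in>A. \<forall>a\<in>C. u \<le> a"
  proof (cases "C = {}")
    case False
    with C show ?thesis
      by (intro assms(1)) (auto simp: Chains_def relation_of_def)
  qed (use \<open>A \<noteq> {}\<close> in auto)
qed

text \<open>
  Finite dimension enters the decomposition through the descending chain condition on subspaces.
  It passes to subspaces without any computation of dimensions.
\<close>

definition (in module) artinian :: bool
  where "artinian \<longleftrightarrow> (\<forall>\<W>. \<W> \<noteq> {} \<and> (\<forall>W\<in>\<W>. submodule R W M) \<longrightarrow>
    (\<exists>W\<in>\<W>. \<forall>W'\<in>\<W>. W' \<subseteq> W \<longrightarrow> W' = W))"

lemma (in vectorspace) fin_dim_imp_artinian: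
  assumes fin_dim
  shows artinian
  unfolding artinian_def
proof (intro allI impI, elim conjE)
  fix \<W> assume ne: "\<W> \<noteq> {}" and sub: "\<forall>W\<in>\<W>. submodule K W V"
  let ?P = "\<lambda>W n. \<exists>A. A \<subseteq> W \<and> lin_indpt A \<and> card A = n"
  let ?N = "\<lambda>W. GREATEST n. ?P W n"
  have bound: "n \<le> dim" if W: "W \<in> \<W>" and P: "?P W n" for W n
  proof -
    obtain A where "A \<subseteq> W" "lin_indpt A" "card A = n" using P by blast
    moreover have "W \<subseteq> carrier V" using sub W submodule.subset by blast
    ultimately show ?thesis using li_le_dim(2)[OF assms, of A] by simp
  qed
  have ex: "?P W 0" for W
    by (intro exI[of _ "{}"]) (auto simp: lin_dep_def)
  \<comment> \<open>a member of least dimension, dimension being the largest size of an independent subset\<close>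
  obtain W where W: "W \<in> \<W>" and min: "\<And>W'. W' \<in> \<W> \<Longrightarrow> ?N W \<le> ?N W'"
  proof -
    obtain W0 where "W0 \<in> \<W>" using ne by blast
    from ex_has_least_nat[of "\<lambda>W. W \<in> \<W>", OF this, of ?N] show ?thesis
      using that by blast
  qed
  show "\<exists>W\<in>\<W>. \<forall>W'\<in>\<W>. W' \<subseteq> W \<longrightarrow> W' = W"
  proof (intro bexI[of _ W] ballI impI W)
    fix W' assume W': "W' \<in> \<W>" "W' \<subseteq> W"
    obtain A where A: "A \<subseteq> W'" "lin_indpt A" "card A = ?N W'"
      using GreatestI_nat[of "?P W'", OF ex bound[OF W'(1)]] by blast
    have WV: "W \<subseteq> carrier V" using sub W submodule.subset by blast
    with A W' have finA: "finite A" by (intro li_le_dim(1)[OF assms]) auto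
    have "v \<in> W'" if v: "v \<in> W" for v
    proof (rule ccontr)
      assume "v \<notin> W'"
      have "span A \<subseteq> W'"
        using sub W'(1) A(1) span_is_subset by blast
      then have "v \<notin> span A" "v \<notin> A" using \<open>v \<notin> W'\<close> A(1) by auto
      then have "lin_indpt (A \<union> {v})"
        using lin_dep_iff_in_span[of A v] A W' WV v by auto
      then have "?P W (Suc (card A))"
        using A(1) W'(2) v \<open>v \<notin> A\<close> finA by (intro exI[of _ "A \<union> {v}"]) auto
      then have "Suc (card A) \<le> ?N W"
        using Greatest_le_nat[of "?P W", OF _ bound[OF W]] by blast
      with min[OF W'(1)] A(3) show False by simp
    qed
    with W'(2) show "W' = W" by auto
  qed
qed

text \<open>
  Cosets of submodules, together with the empty set, described by a closure condition that is
  visibly preserved by linear images and by restriction to the preimage of a point.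
\<close>

definition (in module) affine_subset :: "'c set \<Rightarrow> bool"
  where "affine_subset B \<longleftrightarrow> B \<subseteq> carrier M \<and>
    (\<forall>x\<in>B. \<forall>y\<in>B. \<forall>z\<in>B. \<forall>c\<in>carrier R. x \<oplus>\<^bsub>M\<^esub> c \<odot>\<^bsub>M\<^esub> (y \<ominus>\<^bsub>M\<^esub> z) \<in> B)"

lemma (in module) affine_subset_smult:
  "\<lbrakk>affine_subset B; x \<in> B; y \<in> B; z \<in> B; c \<in> carrier R\<rbrakk> \<Longrightarrow> x \<oplus>\<^bsub>M\<^esub> c \<odot>\<^bsub>M\<^esub> (y \<ominus>\<^bsub>M\<^esub> z) \<in> B"
  by (simp add: affine_subset_def)

lemma (in module) affine_subset_add:
  assumes "affine_subset B" "x \<in> B" "y \<in> B" "z \<in> B"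
  shows "x \<oplus>\<^bsub>M\<^esub> (y \<ominus>\<^bsub>M\<^esub> z) \<in> B"
proof -
  have "y \<in> carrier M" "z \<in> carrier M"
    using assms by (auto simp: affine_subset_def)
  then show ?thesis
    using affine_subset_smult[OF assms, of \<one>] by simp
qed

text \<open>
  A nonempty affine subset is a translate of its direction, the submodule of all differences of
  its elements, so two nested ones with the same direction coincide. The descending chain
  condition therefore passes from submodules, through directions, to nonempty affine subsets.
\<close>

lemma (in module) minimal_affine_subset:
  assumes artinian and ne: "\<B> \<noteq> {}"
    and flat: "\<And>B. B \<in> \<B> \<Longrightarrow> affine_subset B" "\<And>B. B \<in> \<B> \<Longrightarrow> B \<noteq> {}"
  shows "\<exists>B\<in>\<B>. \<forall>B'\<in>\<B>. B' \<subseteq> B \<longrightarrow> B' = B"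
proof -
  define D where "D B = {v. \<exists>y\<in>B. \<exists>z\<in>B. v = y \<ominus>\<^bsub>M\<^esub> z}" for B
  have in_D: "v \<in> D B \<longleftrightarrow> (\<exists>y\<in>B. \<exists>z\<in>B. v = y \<ominus>\<^bsub>M\<^esub> z)" for v B
    unfolding D_def by (rule mem_Collect_eq)
  have sub: "submodule R (D B) M" if B: "affine_subset B" "B \<noteq> {}" for B
  proof (rule submodule.intro)
    have car: "B \<subseteq> carrier M" using B unfolding affine_subset_def by blast
    then show "D B \<subseteq> carrier M" by (auto simp: D_def)
    obtain x where "x \<in> B" using B by blast
    then show "\<zero>\<^bsub>M\<^esub> \<in> D B" using car by (auto simp: in_D M.r_neg M.minus_eq intro!: bexI[of _ x])
    show "v \<oplus>\<^bsub>M\<^esub> w \<in> D B" if "v \<in> D B" "w \<in> D B" for v w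
    proof -
      obtain y z y' z' where *: "v = y \<ominus>\<^bsub>M\<^esub> z" "w = y' \<ominus>\<^bsub>M\<^esub> z'" "y \<in> B" "z \<in> B" "y' \<in> B" "z' \<in> B"
        using \<open>v \<in> D B\<close> \<open>w \<in> D B\<close> unfolding in_D by blast
      then have "y \<oplus>\<^bsub>M\<^esub> (y' \<ominus>\<^bsub>M\<^esub> z') \<in> B"
        using B(1) affine_subset_add by simp
      moreover have cl: "y \<in> carrier M" "z \<in> carrier M" "y' \<in> carrier M" "z' \<in> carrier M"
        using * car by auto
      moreover have "v \<oplus>\<^bsub>M\<^esub> w = (y \<oplus>\<^bsub>M\<^esub> (y' \<ominus>\<^bsub>M\<^esub> z')) \<ominus>\<^bsub>M\<^esub> z"
        using cl by (simp add: * M.minus_eq M.a_ac)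
      ultimately show ?thesis using \<open>z \<in> B\<close> by (auto simp: in_D)
    qed
    show "c \<odot>\<^bsub>M\<^esub> v \<in> D B" if "c \<in> carrier R" "v \<in> D B" for c v
    proof -
      obtain y z where *: "v = y \<ominus>\<^bsub>M\<^esub> z" "y \<in> B" "z \<in> B"
        using \<open>v \<in> D B\<close> unfolding in_D by blast
      then have "z \<oplus>\<^bsub>M\<^esub> c \<odot>\<^bsub>M\<^esub> (y \<ominus>\<^bsub>M\<^esub> z) \<in> B"
        using B(1) \<open>c \<in> carrier R\<close> affine_subset_smult by simp
      moreover have cl: "y \<in> carrier M" "z \<in> carrier M" using * car by auto
      moreover have "c \<odot>\<^bsub>M\<^esub> v = (z \<oplus>\<^bsub>M\<^esub> c \<odot>\<^bsub>M\<^esub> (y \<ominus>\<^bsub>M\<^esub> z)) \<ominus>\<^bsub>M\<^esub> z"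
        using cl \<open>c \<in> carrier R\<close>
        by (simp add: * M.minus_eq M.a_comm[of z] M.a_assoc M.r_neg)
      ultimately show ?thesis using \<open>z \<in> B\<close> by (auto simp: in_D)
    qed
  qed (rule module_axioms)
  have "\<exists>W\<in>D ` \<B>. \<forall>W'\<in>D ` \<B>. W' \<subseteq> W \<longrightarrow> W' = W"
    using \<open>artinian\<close> unfolding artinian_def
  proof (elim allE[of _ "D ` \<B>"] mp, intro conjI ballI)
    show "D ` \<B> \<noteq> {}" using ne by simp
    show "submodule R W M" if "W \<in> D ` \<B>" for W
      using that sub flat by (elim imageE) simp
  qed
  then obtain B where B: "B \<in> \<B>" and min: "\<And>B'. \<lbrakk>B' \<in> \<B>; D B' \<subseteq> D B\<rbrakk> \<Longrightarrow> D B' = D B"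
    unfolding bex_simps ball_simps by metis
  show ?thesis
  proof (intro bexI[of _ B] ballI impI B)
    fix B' assume B': "B' \<in> \<B>" "B' \<subseteq> B"
    then have DB: "D B' = D B" by (intro min) (auto simp only: in_D subset_iff)
    have car: "B \<subseteq> carrier M" and aff: "affine_subset B'"
      using flat(1) B B'(1) unfolding affine_subset_def by blast+
    obtain x' where x': "x' \<in> B'" using flat(2) B' by blast
    have "x \<in> B'" if "x \<in> B" for x
    proof -
      have "x \<ominus>\<^bsub>M\<^esub> x' \<in> D B'" using x' B'(2) \<open>x \<in> B\<close> unfolding DB in_D by blast
      then obtain y z where yz: "x \<ominus>\<^bsub>M\<^esub> x' = y \<ominus>\<^bsub>M\<^esub> z" "y \<in> B'" "z \<in> B'"
        unfolding in_D by blast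
      have cl: "x \<in> carrier M" "x' \<in> carrier M" "y \<in> carrier M" "z \<in> carrier M"
        using car yz x' B'(2) \<open>x \<in> B\<close> by auto
      have "x = x' \<oplus>\<^bsub>M\<^esub> (x \<ominus>\<^bsub>M\<^esub> x')"
        using cl by (simp add: M.minus_eq M.a_lcomm[of x'] M.r_neg)
      also have "\<dots> \<in> B'"
        unfolding yz(1) using affine_subset_add[OF aff x' yz(2,3)] .
      finally show ?thesis .
    qed
    with B' show "B' = B" by auto
  qed
qed

text \<open>
  In particular the intersection of a chain of nonempty affine subsets is one of its members,
  hence nonempty: finite-dimensional affine spaces behave like compact sets.
\<close>

lemma (in module) least_affine_subset:
  assumes artinian "\<B> \<noteq> {}" "\<And>B. B \<in> \<B> \<Longrightarrow> affine_subset B" "\<And>B. B \<in> \<B> \<Longrightarrow> B \<noteq> {}"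
    and chain: "\<And>B B'. \<lbrakk>B \<in> \<B>; B' \<in> \<B>\<rbrakk> \<Longrightarrow> B \<subseteq> B' \<or> B' \<subseteq> B"
  shows "\<Inter>\<B> \<in> \<B>"
proof -
  obtain B where "B \<in> \<B>" and "\<And>B'. B' \<in> \<B> \<Longrightarrow> B' \<subseteq> B \<Longrightarrow> B' = B"
    using minimal_affine_subset[OF assms(1-4)] by blast
  then have "\<Inter>\<B> = B" using chain by blast
  with \<open>B \<in> \<B>\<close> show ?thesis by simp
qed

section \<open>Inverse limits of affine systems\<close>

context persistence_module
begin

sublocale fib: vectorspace K "fibre V t" for t
  by (rule fibre_vs)

lemma tmap_hom: "s \<le> t \<Longrightarrow> mod_hom K (fibre V s) (fibre V t) (tmap V t s)"
  using tmap_linear by (simp add: linear_map_def)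

lemmas tmap_closed [simp] = module_hom_closed[OF mod_hom.f_hom[OF tmap_hom], THEN funcset_mem]
  and tmap_add [simp] = module_hom_add[OF mod_hom.f_hom[OF tmap_hom]]
  and tmap_smult [simp] = module_hom_smult[OF mod_hom.f_hom[OF tmap_hom]]
  and tmap_zero [simp] = mod_hom.f0_is_0[OF tmap_hom]

lemma tmap_minus [simp]:
  assumes "s \<le> t" "x \<in> carrier (fibre V s)" "y \<in> carrier (fibre V s)"
  shows "tmap V t s (x \<ominus>\<^bsub>fibre V s\<^esub> y) = tmap V t s x \<ominus>\<^bsub>fibre V t\<^esub> tmap V t s y"
  using mod_hom.f_neg[OF tmap_hom[OF assms(1)]] assms by (simp add: a_minus_def)

lemma affine_subset_image_tmap:
  assumes "s \<le> t" and B: "fib.affine_subset s B"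
  shows "fib.affine_subset t (tmap V t s ` B)"
proof -
  have car: "B \<subseteq> carrier (fibre V s)" using B by (simp add: fib.affine_subset_def)
  show ?thesis
    unfolding fib.affine_subset_def
  proof (intro conjI ballI)
    show "tmap V t s ` B \<subseteq> carrier (fibre V t)"
      using car \<open>s \<le> t\<close> by auto
    fix x y z c assume "x \<in> tmap V t s ` B" "y \<in> tmap V t s ` B" "z \<in> tmap V t s ` B" and c: "c \<in> carrier K"
    then obtain x' y' z' where *: "x' \<in> B" "y' \<in> B" "z' \<in> B"
      and "x = tmap V t s x'" "y = tmap V t s y'" "z = tmap V t s z'" by (elim imageE)
    moreover have "x' \<in> carrier (fibre V s)" "y' \<in> carrier (fibre V s)" "z' \<in> carrier (fibre V s)"
      using car * by auto
    ultimately have "x \<oplus>\<^bsub>fibre V t\<^esub> c \<odot>\<^bsub>fibre V t\<^esub> (y \<ominus>\<^bsub>fibre V t\<^esub> z)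
        = tmap V t s (x' \<oplus>\<^bsub>fibre V s\<^esub> c \<odot>\<^bsub>fibre V s\<^esub> (y' \<ominus>\<^bsub>fibre V s\<^esub> z'))"
      using c \<open>s \<le> t\<close> by simp
    with fib.affine_subset_smult[OF B * c]
    show "x \<oplus>\<^bsub>fibre V t\<^esub> c \<odot>\<^bsub>fibre V t\<^esub> (y \<ominus>\<^bsub>fibre V t\<^esub> z) \<in> tmap V t s ` B" by simp
  qed
qed

lemma affine_subset_singleton:
  assumes "x \<in> carrier (fibre V t)"
  shows "fib.affine_subset t {x}"
  using assms by (simp add: fib.affine_subset_def fib.M.minus_eq fib.M.r_neg)

lemma affine_subset_fibre_tmap:
  assumes "s \<le> t" and B: "fib.affine_subset s B" and y: "y \<in> carrier (fibre V t)"
  shows "fib.affine_subset s {x \<in> B. tmap V t s x = y}"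
  unfolding fib.affine_subset_def
proof (intro conjI ballI CollectI)
  have car: "B \<subseteq> carrier (fibre V s)" using B by (simp add: fib.affine_subset_def)
  then show "{x \<in> B. tmap V t s x = y} \<subseteq> carrier (fibre V s)" by auto
  fix u v w c
  assume *: "u \<in> {x \<in> B. tmap V t s x = y}" "v \<in> {x \<in> B. tmap V t s x = y}"
    "w \<in> {x \<in> B. tmap V t s x = y}" and c: "c \<in> carrier K"
  then show "u \<oplus>\<^bsub>fibre V s\<^esub> c \<odot>\<^bsub>fibre V s\<^esub> (v \<ominus>\<^bsub>fibre V s\<^esub> w) \<in> B"
    using fib.affine_subset_smult[OF B] by simp
  have "u \<in> carrier (fibre V s)" "v \<in> carrier (fibre V s)" "w \<in> carrier (fibre V s)"
    using car * by auto
  moreover have [simp]: "y \<ominus>\<^bsub>fibre V t\<^esub> y = \<zero>\<^bsub>fibre V t\<^esub>"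
    using fib.M.r_neg[OF y] by (simp add: a_minus_def)
  ultimately show "tmap V t s (u \<oplus>\<^bsub>fibre V s\<^esub> c \<odot>\<^bsub>fibre V s\<^esub> (v \<ominus>\<^bsub>fibre V s\<^esub> w)) = y"
    using * c y \<open>s \<le> t\<close> by simp
qed

end

locale artinian_persistence_module = persistence_module K V
  for K :: "('a, 'm) ring_scheme" and V :: "('r::linorder, 'a, 'v) pers_mod" +
  assumes artinian_fibre: "module.artinian K (fibre V t)"

lemma (in pfd_persistence_module) pfd_imp_artinian: "artinian_persistence_module K V"
  by unfold_locales (use fib.fin_dim_imp_artinian pointwise_fin_dim in blast)

context artinian_persistence_module
begin

definition affine_system :: "'r set \<Rightarrow> ('r \<Rightarrow> 'v set) \<Rightarrow> bool"
  where "affine_system S B \<longleftrightarrow>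
    (\<forall>s\<in>S. fib.affine_subset s (B s) \<and> B s \<noteq> {}) \<and>
    (\<forall>r\<in>S. \<forall>s\<in>S. r \<le> s \<longrightarrow> tmap V s r ` B r \<subseteq> B s)"

lemma affine_systemD:
  assumes "affine_system S B" "s \<in> S"
  shows "fib.affine_subset s (B s)" "B s \<noteq> {}" "B s \<subseteq> carrier (fibre V s)"
    "r \<in> S \<Longrightarrow> r \<le> s \<Longrightarrow> x \<in> B r \<Longrightarrow> tmap V s r x \<in> B s"
proof -
  show "fib.affine_subset s (B s)" "B s \<noteq> {}"
    using assms by (auto simp: affine_system_def)
  then show "B s \<subseteq> carrier (fibre V s)" by (simp add: fib.affine_subset_def)
  show "tmap V s r x \<in> B s" if "r \<in> S" "r \<le> s" "x \<in> B r"
  proof -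
    have "tmap V s r ` B r \<subseteq> B s" using assms that(1,2) by (simp add: affine_system_def)
    with that(3) show ?thesis by (meson imageI subsetD)
  qed
qed

lemma affine_system_Inter:
  assumes "\<B> \<noteq> {}" and sys: "\<And>B. B \<in> \<B> \<Longrightarrow> affine_system S B"
    and chain: "\<And>B B'. \<lbrakk>B \<in> \<B>; B' \<in> \<B>\<rbrakk> \<Longrightarrow> B \<le> B' \<or> B' \<le> B"
  shows "affine_system S (\<lambda>s. \<Inter>B\<in>\<B>. B s)"
  unfolding affine_system_def
proof (intro conjI ballI impI)
  fix s assume s: "s \<in> S"
  have "(\<Inter>B\<in>\<B>. B s) \<in> (\<lambda>B. B s) ` \<B>"
  proof (rule fib.least_affine_subset[OF artinian_fibre])
    show "(\<lambda>B. B s) ` \<B> \<noteq> {}" using assms(1) by simp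
    show "fib.affine_subset s C" "C \<noteq> {}" if "C \<in> (\<lambda>B. B s) ` \<B>" for C
      using that affine_systemD(1,2)[OF sys s] by (elim imageE; simp)+
    show "C \<subseteq> C' \<or> C' \<subseteq> C" if "C \<in> (\<lambda>B. B s) ` \<B>" "C' \<in> (\<lambda>B. B s) ` \<B>" for C C'
      using that chain unfolding le_fun_def by (elim imageE) metis
  qed
  then obtain B where "B \<in> \<B>" "(\<Inter>B\<in>\<B>. B s) = B s" by (elim imageE)
  with affine_systemD(1,2)[OF sys s]
  show "fib.affine_subset s (\<Inter>B\<in>\<B>. B s)" "(\<Inter>B\<in>\<B>. B s) \<noteq> {}" by simp_all
next
  fix r s assume rs: "r \<in> S" "s \<in> S" "r \<le> s"
  then have "tmap V s r ` B r \<subseteq> B s" if "B \<in> \<B>" for B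
    using affine_systemD(4)[OF sys[OF that]] by (intro image_subsetI) simp
  then show "tmap V s r ` (\<Inter>B\<in>\<B>. B r) \<subseteq> (\<Inter>B\<in>\<B>. B s)" by fastforce
qed

text \<open>
  Each stable image is the intersection of a chain of nonempty affine sets, hence equal to one of
  the images, and so nonempty. The transition maps respect stable images because the order is
  total.
\<close>

lemma affine_system_stable_images:
  assumes sys: "affine_system S B"
  shows "affine_system S (\<lambda>s. \<Inter>r\<in>{r \<in> S. r \<le> s}. tmap V s r ` B r)"
  unfolding affine_system_def
proof (intro conjI ballI impI)
  fix s assume s: "s \<in> S"
  let ?I = "\<lambda>r. tmap V s r ` B r"
  have I: "fib.affine_subset s (?I r)" "?I r \<noteq> {}" if "r \<in> S" "r \<le> s" for r
    using affine_systemD(1,2)[OF sys that(1)] affine_subset_image_tmap[OF that(2)] by simp_all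
  have mono: "?I q \<subseteq> ?I r" if "q \<in> S" "r \<in> S" "q \<le> r" "r \<le> s" for q r
  proof (rule image_subsetI)
    fix x assume x: "x \<in> B q"
    then have "tmap V s q x = tmap V s r (tmap V r q x)"
      using tmap_comp that affine_systemD(3)[OF sys that(1)] by auto
    then show "tmap V s q x \<in> ?I r" using affine_systemD(4)[OF sys that(2,1,3) x] by simp
  qed
  define X where "X = \<Inter>(?I ` {r \<in> S. r \<le> s})"
  have "X \<in> ?I ` {r \<in> S. r \<le> s}"
    unfolding X_def
  proof (rule fib.least_affine_subset[OF artinian_fibre])
    show "?I ` {r \<in> S. r \<le> s} \<noteq> {}" using s by auto
    show "fib.affine_subset s C" "C \<noteq> {}" if "C \<in> ?I ` {r \<in> S. r \<le> s}" for C
      using that I by (elim imageE; simp)+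
    show "C \<subseteq> C' \<or> C' \<subseteq> C" if CC': "C \<in> ?I ` {r \<in> S. r \<le> s}" "C' \<in> ?I ` {r \<in> S. r \<le> s}" for C C'
    proof -
      obtain q r where *: "C = ?I q" "q \<in> S" "q \<le> s" "C' = ?I r" "r \<in> S" "r \<le> s"
        using CC' by (elim imageE) simp
      show ?thesis
        by (cases q r rule: le_cases) (simp_all add: * mono)
    qed
  qed
  then obtain r where "r \<in> S" "r \<le> s" "X = ?I r"
    by blast
  with I have "fib.affine_subset s X" "X \<noteq> {}" by simp_all
  then show "fib.affine_subset s (\<Inter>r\<in>{r \<in> S. r \<le> s}. ?I r)" "(\<Inter>r\<in>{r \<in> S. r \<le> s}. ?I r) \<noteq> {}"
    unfolding X_def by this+
next
  fix r s assume rs: "r \<in> S" "s \<in> S" "r \<le> s"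
  show "tmap V s r ` (\<Inter>q\<in>{q \<in> S. q \<le> r}. tmap V r q ` B q) \<subseteq> (\<Inter>q\<in>{q \<in> S. q \<le> s}. tmap V s q ` B q)"
  proof (intro image_subsetI INT_I)
    fix x q assume x: "x \<in> (\<Inter>q\<in>{q \<in> S. q \<le> r}. tmap V r q ` B q)" and q: "q \<in> {q \<in> S. q \<le> s}"
    have "x \<in> tmap V r r ` B r" using x rs(1) by simp
    then have xr: "x \<in> B r" using affine_systemD(4)[OF sys rs(1,1)] by auto
    show "tmap V s r x \<in> tmap V s q ` B q"
    proof (cases "q \<le> r")
      case True
      with x q have "x \<in> tmap V r q ` B q" by simp
      then obtain y where y: "y \<in> B q" "x = tmap V r q y" by (elim imageE)
      then have "tmap V s r x = tmap V s q y"
        using tmap_comp[OF True rs(3)] affine_systemD(3)[OF sys] q by auto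
      with y show ?thesis by simp
    next
      case False
      then have "r \<le> q" by simp
      then have "tmap V s r x = tmap V s q (tmap V q r x)"
        using tmap_comp[of r q s x] affine_systemD(3)[OF sys rs(1)] xr q by auto
      then show ?thesis
        using affine_systemD(4)[OF sys _ rs(1) \<open>r \<le> q\<close> xr] q by simp
    qed
  qed
qed

text \<open>
  The inverse limit of an affine system is nonempty, over any index set \<open>S\<close>.
  Surjective transition maps do not suffice for this in long systems of sets; instead, choose a
  minimal affine subsystem by Zorn's lemma. Minimality forces it to equal its system of stable
  images, so its transition maps are surjective; then the part of it that lies over a single point
  \<open>x\<close> of one of its members is again an affine subsystem, so by minimality all
  members are singletons. Their elements form the required compatible family.
\<close>

lemma compatible_choice:
  assumes A: "affine_system S A"
  obtains a where "\<And>s. s \<in> S \<Longrightarrow> a s \<in> A s"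
    and "\<And>r s. \<lbrakk>r \<in> S; s \<in> S; r \<le> s\<rbrakk> \<Longrightarrow> tmap V s r (a r) = a s"
proof -
  let ?F = "{B. affine_system S B \<and> B \<le> A}"
  have "\<exists>B\<in>?F. \<forall>B'\<in>?F. B' \<le> B \<longrightarrow> B' = B"
  proof (rule Zorn_minimal)
    show "?F \<noteq> {}" using A by auto
    fix \<B> assume \<B>: "\<B> \<subseteq> ?F" "\<B> \<noteq> {}" "\<And>x y. \<lbrakk>x \<in> \<B>; y \<in> \<B>\<rbrakk> \<Longrightarrow> x \<le> y \<or> y \<le> x"
    let ?I = "\<lambda>s. \<Inter>B\<in>\<B>. B s"
    have lower: "?I \<le> B" if "B \<in> \<B>" for B
      using INF_lower[OF that] by (intro le_funI)
    obtain B where B: "B \<in> \<B>" using \<B>(2) by (meson all_not_in_conv)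
    with \<B>(1) have "B \<le> A" by (simp add: subset_iff)
    with lower[OF B] have "?I \<le> A" by (rule order_trans)
    moreover have "affine_system S ?I"
      using \<B> by (intro affine_system_Inter) (simp_all add: subset_iff)
    ultimately show "\<exists>u\<in>?F. \<forall>x\<in>\<B>. u \<le> x"
      using lower by (intro bexI[of _ ?I] ballI CollectI conjI)
  qed
  then obtain B where sys: "affine_system S B" and BA: "B \<le> A"
    and min: "\<And>B'. \<lbrakk>affine_system S B'; B' \<le> B\<rbrakk> \<Longrightarrow> B' = B"
  proof (elim bexE)
    fix B assume *: "B \<in> ?F" "\<forall>B'\<in>?F. B' \<le> B \<longrightarrow> B' = B"
    show thesis
    proof (rule that)
      show "B' = B" if "affine_system S B'" "B' \<le> B" for B'
        using *(2)[rule_format, of B'] that * order_trans[OF that(2)] by simp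
    qed (use * in simp_all)
  qed
  have surj: "B s \<subseteq> tmap V s r ` B r" if "r \<in> S" "s \<in> S" "r \<le> s" for r s
  proof -
    let ?B = "\<lambda>s. if s \<in> S then \<Inter>r\<in>{r \<in> S. r \<le> s}. tmap V s r ` B r else B s"
    have "affine_system S ?B"
      using affine_system_stable_images[OF sys] by (simp add: affine_system_def)
    moreover have "?B \<le> B"
    proof (rule le_funI)
      fix s
      have "tmap V s s ` B s \<subseteq> B s" if "s \<in> S"
        using affine_systemD(4)[OF sys that that] by auto
      moreover have "(\<Inter>r\<in>{r \<in> S. r \<le> s}. tmap V s r ` B r) \<subseteq> tmap V s s ` B s" if "s \<in> S"
        using that by (intro INF_lower) simp
      ultimately show "?B s \<le> B s" by simp (meson order_trans)
    qed
    ultimately have "?B s = B s" by (intro fun_cong[of ?B B] min)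
    with that show ?thesis by auto
  qed
  have single: "B s = {x}" if s: "s \<in> S" and x: "x \<in> B s" for s x
  proof -
    have xc: "x \<in> carrier (fibre V s)" using affine_systemD(3)[OF sys s] x by auto
    \<comment> \<open>the elements that map to the chosen point from below, and the images of that point above\<close>
    let ?B = "\<lambda>r. if r \<notin> S then B r else if r \<le> s then {y \<in> B r. tmap V s r y = x} else {tmap V r s x}"
    have "affine_system S ?B"
      unfolding affine_system_def
    proof (intro conjI ballI impI)
      fix r assume r: "r \<in> S"
      show "fib.affine_subset r (?B r)"
        using r xc affine_systemD(1)[OF sys r] by (auto intro!: affine_subset_singleton affine_subset_fibre_tmap)
      show "?B r \<noteq> {}"
        using r surj[OF r s] x by auto
    next
      fix q r assume qr: "q \<in> S" "r \<in> S" "q \<le> r"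
      show "tmap V r q ` ?B q \<subseteq> ?B r"
      proof (rule image_subsetI)
        fix y assume y: "y \<in> ?B q"
        show "tmap V r q y \<in> ?B r"
        proof (cases "q \<le> s")
          case True
          with y qr have yB: "y \<in> B q" "tmap V s q y = x" by auto
          then have yc: "y \<in> carrier (fibre V q)" using affine_systemD(3)[OF sys qr(1)] by auto
          show ?thesis
          proof (cases "r \<le> s")
            case True
            then show ?thesis
              using yB yc qr affine_systemD(4)[OF sys qr(2,1,3)] tmap_comp[OF qr(3) True] by auto
          next
            case False
            then show ?thesis
              using yB yc qr tmap_comp[OF \<open>q \<le> s\<close>, of r y] by auto
          qed
        next
          case False
          then have "s \<le> q" by simp
          then show ?thesis
            using False y qr tmap_comp[of s q r x] xc by auto
        qed
      qed
    qed
    moreover have "?B \<le> B"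
      using affine_systemD(4)[OF sys _ s _ x] by (auto simp: le_fun_def)
    ultimately have "?B s = B s" by (intro fun_cong[of ?B B] min)
    moreover have "?B s \<subseteq> {x}"
    proof (rule subsetI)
      fix y assume "y \<in> ?B s"
      with s have "y \<in> B s" "tmap V s s y = x" by simp_all
      then show "y \<in> {x}" using tmap_id[of y s] affine_systemD(3)[OF sys s] by (simp add: subset_iff)
    qed
    ultimately have "B s \<subseteq> {x}" by (rule ord_eq_le_trans[OF sym])
    with x show ?thesis by (intro equalityI) simp_all
  qed
  define a where "a s = (SOME x. x \<in> B s)" for s
  have a: "a s \<in> B s" if "s \<in> S" for s
    unfolding a_def using affine_systemD(2)[OF sys that] by (simp add: some_in_eq)
  show thesis
  proof
    show "a s \<in> A s" if "s \<in> S" for s using a[OF that] BA by (auto simp: le_fun_def)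
    show "tmap V s r (a r) = a s" if "r \<in> S" "s \<in> S" "r \<le> s" for r s
      using single[OF that(2) a[OF that(2)]] affine_systemD(4)[OF sys that(2,1,3) a[OF that(1)]] by auto
  qed
qed

end

section \<open>Compatible functionals\<close>

definition linear_functional :: "('a, 'm) ring_scheme \<Rightarrow> ('a, 'v, 'n) module_scheme \<Rightarrow> ('v \<Rightarrow> 'a) \<Rightarrow> bool"
  where "linear_functional K M f \<longleftrightarrow>
    (\<forall>x\<in>carrier M. f x \<in> carrier K) \<and>
    (\<forall>x\<in>carrier M. \<forall>y\<in>carrier M. f (x \<oplus>\<^bsub>M\<^esub> y) = f x \<oplus>\<^bsub>K\<^esub> f y) \<and>
    (\<forall>c\<in>carrier K. \<forall>x\<in>carrier M. f (c \<odot>\<^bsub>M\<^esub> x) = c \<otimes>\<^bsub>K\<^esub> f x)"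

lemma linear_functionalD:
  assumes "linear_functional K M f"
  shows "x \<in> carrier M \<Longrightarrow> f x \<in> carrier K"
    "\<lbrakk>x \<in> carrier M; y \<in> carrier M\<rbrakk> \<Longrightarrow> f (x \<oplus>\<^bsub>M\<^esub> y) = f x \<oplus>\<^bsub>K\<^esub> f y"
    "\<lbrakk>c \<in> carrier K; x \<in> carrier M\<rbrakk> \<Longrightarrow> f (c \<odot>\<^bsub>M\<^esub> x) = c \<otimes>\<^bsub>K\<^esub> f x"
  using assms by (simp_all add: linear_functional_def)

lemma (in module) linear_functional_zero:
  assumes "linear_functional R M f"
  shows "f \<zero>\<^bsub>M\<^esub> = \<zero>"
proof -
  have "f (\<zero> \<odot>\<^bsub>M\<^esub> \<zero>\<^bsub>M\<^esub>) = \<zero> \<otimes> f \<zero>\<^bsub>M\<^esub>"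
    by (rule linear_functionalD(3)[OF assms]) simp_all
  then show ?thesis
    using linear_functionalD(1)[OF assms, of "\<zero>\<^bsub>M\<^esub>"] by simp
qed

lemma (in module) submodule_minus:
  assumes "submodule R N M" "x \<in> N" "y \<in> N"
  shows "x \<ominus>\<^bsub>M\<^esub> y \<in> N"
proof -
  have "y \<in> carrier M" using assms(1,3) submodule.subset by auto
  then have "\<ominus>\<^bsub>M\<^esub> y = (\<ominus> \<one>) \<odot>\<^bsub>M\<^esub> y" by (simp add: smult_minus_1)
  also have "\<dots> \<in> N" using assms(3) by (intro submodule.smult_closed[OF assms(1)] R.a_inv_closed R.one_closed)
  finally show ?thesis using assms by (simp add: a_minus_def submodule.m_closed)
qed

lemma (in module) minus_minus_cancel_left:
  assumes "v \<in> carrier M" "x \<in> carrier M" "y \<in> carrier M"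
  shows "(v \<ominus>\<^bsub>M\<^esub> x) \<ominus>\<^bsub>M\<^esub> (v \<ominus>\<^bsub>M\<^esub> y) = y \<ominus>\<^bsub>M\<^esub> x"
proof -
  have "(v \<ominus>\<^bsub>M\<^esub> x) \<ominus>\<^bsub>M\<^esub> (v \<ominus>\<^bsub>M\<^esub> y) = (v \<oplus>\<^bsub>M\<^esub> \<ominus>\<^bsub>M\<^esub> x) \<oplus>\<^bsub>M\<^esub> (\<ominus>\<^bsub>M\<^esub> v \<oplus>\<^bsub>M\<^esub> y)"
    using assms by (simp add: a_minus_def M.minus_add)
  also have "\<dots> = v \<oplus>\<^bsub>M\<^esub> (\<ominus>\<^bsub>M\<^esub> v \<oplus>\<^bsub>M\<^esub> (\<ominus>\<^bsub>M\<^esub> x \<oplus>\<^bsub>M\<^esub> y))"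
    using assms by (simp add: M.a_assoc M.a_lcomm)
  also have "\<dots> = y \<ominus>\<^bsub>M\<^esub> x"
    using assms by (simp add: M.r_neg2 a_minus_def M.a_comm)
  finally show ?thesis .
qed

lemma (in vectorspace) exists_inverse:
  assumes "c \<in> carrier K" "c \<noteq> \<zero>\<^bsub>K\<^esub>"
  obtains d where "d \<in> carrier K" "d \<otimes>\<^bsub>K\<^esub> c = \<one>\<^bsub>K\<^esub>"
  using assms field_Units by (metis DiffI Units_inv_closed Units_l_inv singletonD)

lemma (in vectorspace) submodule_smult_cancel:
  assumes N: "submodule K N V" and c: "c \<in> carrier K" "c \<noteq> \<zero>\<^bsub>K\<^esub>"
    and x: "x \<in> carrier V" and "c \<odot>\<^bsub>V\<^esub> x \<in> N"
  shows "x \<in> N"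
proof -
  obtain d where d: "d \<in> carrier K" "d \<otimes>\<^bsub>K\<^esub> c = \<one>\<^bsub>K\<^esub>" by (rule exists_inverse[OF c])
  have "x = d \<odot>\<^bsub>V\<^esub> (c \<odot>\<^bsub>V\<^esub> x)" using smult_assoc1[OF d(1) c(1) x] d x by simp
  also have "\<dots> \<in> N" using submodule.smult_closed[OF N d(1)] assms(5) .
  finally show ?thesis .
qed

context persistence_module
begin

text \<open>
  A family of subspaces, closed under the structure maps, none of which contains the corresponding
  member of the family \<open>a\<close>. A maximal one consists of hyperplanes, the kernels of
  functionals that do not vanish on \<open>a\<close>.
\<close>

definition avoiding_system :: "'r set \<Rightarrow> ('r \<Rightarrow> 'v) \<Rightarrow> ('r \<Rightarrow> 'v set) \<Rightarrow> bool"
  where "avoiding_system U a H \<longleftrightarrow>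
    (\<forall>u\<in>U. submodule K (H u) (fibre V u) \<and> a u \<notin> H u) \<and>
    (\<forall>u\<in>U. \<forall>w\<in>U. u \<le> w \<longrightarrow> (\<forall>x\<in>H u. tmap V w u x \<in> H w))"

lemma avoiding_systemD:
  assumes "avoiding_system U a H" "u \<in> U"
  shows "submodule K (H u) (fibre V u)" "a u \<notin> H u" "x \<in> H u \<Longrightarrow> x \<in> carrier (fibre V u)"
    "\<lbrakk>w \<in> U; u \<le> w; x \<in> H u\<rbrakk> \<Longrightarrow> tmap V w u x \<in> H w"
proof -
  show "submodule K (H u) (fibre V u)" "a u \<notin> H u"
    using assms by (auto simp: avoiding_system_def)
  then show "x \<in> H u \<Longrightarrow> x \<in> carrier (fibre V u)" using submodule.subset by auto
  show "\<lbrakk>w \<in> U; u \<le> w; x \<in> H u\<rbrakk> \<Longrightarrow> tmap V w u x \<in> H w"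
    using assms by (simp add: avoiding_system_def)
qed

lemma submodule_zero: "submodule K {\<zero>\<^bsub>fibre V u\<^esub>} (fibre V u)"
  by (rule submodule.intro) (simp_all add: fib.module_axioms)

lemma avoiding_system_Union:
  assumes "\<H> \<noteq> {}" and sys: "\<And>H. H \<in> \<H> \<Longrightarrow> avoiding_system U a H"
    and chain: "\<And>H H'. \<lbrakk>H \<in> \<H>; H' \<in> \<H>\<rbrakk> \<Longrightarrow> H \<le> H' \<or> H' \<le> H"
  shows "avoiding_system U a (\<lambda>u. \<Union>H\<in>\<H>. H u)"
  unfolding avoiding_system_def
proof (intro conjI ballI impI)
  fix u assume u: "u \<in> U"
  show "submodule K (\<Union>H\<in>\<H>. H u) (fibre V u)"
  proof (rule submodule.intro)
    show "(\<Union>H\<in>\<H>. H u) \<subseteq> carrier (fibre V u)"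
      using avoiding_systemD(3)[OF sys u] by (intro UN_least subsetI)
    obtain H where "H \<in> \<H>" using \<open>\<H> \<noteq> {}\<close> by (meson all_not_in_conv)
    then show "\<zero>\<^bsub>fibre V u\<^esub> \<in> (\<Union>H\<in>\<H>. H u)"
      using submodule.zero_closed[OF avoiding_systemD(1)[OF sys u]] by (intro UN_I)
    fix v w assume "v \<in> (\<Union>H\<in>\<H>. H u)" "w \<in> (\<Union>H\<in>\<H>. H u)"
    then obtain H H' where H: "H \<in> \<H>" "v \<in> H u" "H' \<in> \<H>" "w \<in> H' u" by (elim UN_E)
    then obtain H'' where "H'' \<in> \<H>" "v \<in> H'' u" "w \<in> H'' u"
      using chain[OF H(1,3)] by (metis le_funD subsetD)
    then show "v \<oplus>\<^bsub>fibre V u\<^esub> w \<in> (\<Union>H\<in>\<H>. H u)"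
      using submodule.m_closed[OF avoiding_systemD(1)[OF sys u]] by (intro UN_I)
  next
    fix c v assume c: "c \<in> carrier K" and "v \<in> (\<Union>H\<in>\<H>. H u)"
    then obtain H where "H \<in> \<H>" "v \<in> H u" by (elim UN_E)
    then show "c \<odot>\<^bsub>fibre V u\<^esub> v \<in> (\<Union>H\<in>\<H>. H u)"
      using submodule.smult_closed[OF avoiding_systemD(1)[OF sys u] c] by (intro UN_I)
  qed (rule fib.module_axioms)
  show "a u \<notin> (\<Union>H\<in>\<H>. H u)"
    using avoiding_systemD(2)[OF sys u] by simp
next
  fix u w x assume uw: "u \<in> U" "w \<in> U" "u \<le> w" and "x \<in> (\<Union>H\<in>\<H>. H u)"
  then obtain H where "H \<in> \<H>" "x \<in> H u" by (elim UN_E)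
  then show "tmap V w u x \<in> (\<Union>H\<in>\<H>. H w)"
    using avoiding_systemD(4)[OF sys uw] by (intro UN_I)
qed

text \<open>
  The vectors that eventually enter \<open>H\<close> form a larger avoiding system: if
  \<open>a u\<close> were such a vector, then some \<open>a w\<close> would lie in
  \<open>H w\<close>.
\<close>

lemma avoiding_system_saturation:
  assumes sys: "avoiding_system U a H"
    and a: "\<And>u. u \<in> U \<Longrightarrow> a u \<in> carrier (fibre V u)"
    and compat: "\<And>u w. \<lbrakk>u \<in> U; w \<in> U; u \<le> w\<rbrakk> \<Longrightarrow> tmap V w u (a u) = a w"
  shows "avoiding_system U a
    (\<lambda>u. {x \<in> carrier (fibre V u). \<exists>w\<in>U. u \<le> w \<and> tmap V w u x \<in> H w})"
    (is "avoiding_system U a ?S")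
  unfolding avoiding_system_def
proof (intro conjI ballI impI)
  have later: "tmap V w u x \<in> H w"
    if "u \<le> v" "v \<le> w" "v \<in> U" "w \<in> U" "x \<in> carrier (fibre V u)" "tmap V v u x \<in> H v" for u v w x
    using avoiding_systemD(4)[OF sys that(3,4,2,6)] tmap_comp[OF that(1,2,5)] by simp
  {
    fix u assume u: "u \<in> U"
    show "submodule K (?S u) (fibre V u)"
    proof (rule submodule.intro)
      show "?S u \<subseteq> carrier (fibre V u)" by auto
      show "\<zero>\<^bsub>fibre V u\<^esub> \<in> ?S u"
        using submodule.zero_closed[OF avoiding_systemD(1)[OF sys u]] u by (auto intro!: bexI[of _ u])
      fix x y assume x: "x \<in> ?S u" and y: "y \<in> ?S u"
      then obtain v w where *: "v \<in> U" "u \<le> v" "tmap V v u x \<in> H v" "w \<in> U" "u \<le> w" "tmap V w u y \<in> H w"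
        by (elim CollectE conjE bexE)
      have xy: "x \<in> carrier (fibre V u)" "y \<in> carrier (fibre V u)" using x y by simp_all
      have m: "max v w \<in> U" "v \<le> max v w" "w \<le> max v w" "u \<le> max v w"
        using * by (auto simp: max_def)
      have "tmap V (max v w) u x \<in> H (max v w)" "tmap V (max v w) u y \<in> H (max v w)"
        using later[OF *(2) m(2) *(1) m(1) xy(1) *(3)] later[OF *(5) m(3) *(4) m(1) xy(2) *(6)] by simp_all
      then have "tmap V (max v w) u (x \<oplus>\<^bsub>fibre V u\<^esub> y) \<in> H (max v w)"
        using submodule.m_closed[OF avoiding_systemD(1)[OF sys m(1)]] xy m(4) by simp
      with m xy show "x \<oplus>\<^bsub>fibre V u\<^esub> y \<in> ?S u" by auto
    next
      fix c x assume c: "c \<in> carrier K" and x: "x \<in> ?S u"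
      then obtain v where v: "v \<in> U" "u \<le> v" "tmap V v u x \<in> H v" "x \<in> carrier (fibre V u)"
        by (elim CollectE conjE bexE)
      then have "tmap V v u (c \<odot>\<^bsub>fibre V u\<^esub> x) \<in> H v"
        using submodule.smult_closed[OF avoiding_systemD(1)[OF sys v(1)] c] c by simp
      with v c show "c \<odot>\<^bsub>fibre V u\<^esub> x \<in> ?S u" by auto
    qed (rule fib.module_axioms)
    show "a u \<notin> ?S u"
      using compat[OF u] avoiding_systemD(2)[OF sys] by auto
  next
    fix u w x assume uw: "u \<in> U" "w \<in> U" "u \<le> w" and x: "x \<in> ?S u"
    then obtain v where v: "v \<in> U" "u \<le> v" "tmap V v u x \<in> H v" "x \<in> carrier (fibre V u)"
      by (elim CollectE conjE bexE)
    have m: "max v w \<in> U" "v \<le> max v w" "w \<le> max v w"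
      using v uw by (auto simp: max_def)
    have "tmap V (max v w) w (tmap V w u x) \<in> H (max v w)"
      using later[OF v(2) m(2) v(1) m(1) v(4,3)] tmap_comp[OF uw(3) m(3) v(4)] by simp
    with m uw v show "tmap V w u x \<in> ?S w" by (auto intro!: bexI[of _ "max v w"])
  }
qed

text \<open>
  Adding \<open>v\<close> forces its images to be added at all later indices. Maximality of an
  avoiding system therefore yields a relation between \<open>a w\<close> and the image of
  \<open>v\<close> at some later \<open>w\<close>, from which saturation brings it back to
  \<open>u\<close>.
\<close>

lemma avoiding_system_add_vector:
  assumes sys: "avoiding_system U a H" and u: "u \<in> U" and v: "v \<in> carrier (fibre V u)"
    and avoid: "\<And>w h c. \<lbrakk>w \<in> U; u \<le> w; h \<in> H w; c \<in> carrier K\<rbrakk>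
      \<Longrightarrow> a w \<noteq> h \<oplus>\<^bsub>fibre V w\<^esub> c \<odot>\<^bsub>fibre V w\<^esub> tmap V w u v"
  shows "avoiding_system U a (\<lambda>w. if u \<le> w
    then {h \<oplus>\<^bsub>fibre V w\<^esub> c \<odot>\<^bsub>fibre V w\<^esub> tmap V w u v | h c. h \<in> H w \<and> c \<in> carrier K} else H w)"
    (is "avoiding_system U a ?S")
  unfolding avoiding_system_def
proof (intro conjI ballI impI)
  have SI: "h \<oplus>\<^bsub>fibre V w\<^esub> c \<odot>\<^bsub>fibre V w\<^esub> tmap V w u v \<in> ?S w"
    if "u \<le> w" "h \<in> H w" "c \<in> carrier K" for w h c
    using that by auto
  have SE: "\<exists>h c. h \<in> H w \<and> c \<in> carrier K \<and> x = h \<oplus>\<^bsub>fibre V w\<^esub> c \<odot>\<^bsub>fibre V w\<^esub> tmap V w u v"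
    if "x \<in> ?S w" "u \<le> w" for x w
    using that by auto
  {
    fix w assume w: "w \<in> U"
    note sub = avoiding_systemD(1)[OF sys w]
    note car = avoiding_systemD(3)[OF sys w]
    show "submodule K (?S w) (fibre V w)"
    proof (cases "u \<le> w")
      case True
      have tv: "tmap V w u v \<in> carrier (fibre V w)" using True v by simp
      show ?thesis
      proof (rule submodule.intro)
        show "?S w \<subseteq> carrier (fibre V w)"
          using SE[OF _ True] car tv by (auto 0 3)
        show "\<zero>\<^bsub>fibre V w\<^esub> \<in> ?S w"
          using SI[OF True submodule.zero_closed[OF sub], of "\<zero>\<^bsub>K\<^esub>"] tv by simp
        fix x y assume "x \<in> ?S w" "y \<in> ?S w"
        then obtain h c h' c' where *: "h \<in> H w" "c \<in> carrier K" "h' \<in> H w" "c' \<in> carrier K"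
          "x = h \<oplus>\<^bsub>fibre V w\<^esub> c \<odot>\<^bsub>fibre V w\<^esub> tmap V w u v" "y = h' \<oplus>\<^bsub>fibre V w\<^esub> c' \<odot>\<^bsub>fibre V w\<^esub> tmap V w u v"
          using SE[OF _ True] by meson
        then have "x \<oplus>\<^bsub>fibre V w\<^esub> y = (h \<oplus>\<^bsub>fibre V w\<^esub> h') \<oplus>\<^bsub>fibre V w\<^esub> (c \<oplus>\<^bsub>K\<^esub> c') \<odot>\<^bsub>fibre V w\<^esub> tmap V w u v"
          using car tv by (simp add: fib.smult_l_distr fib.M.a_ac)
        then show "x \<oplus>\<^bsub>fibre V w\<^esub> y \<in> ?S w"
          using SI[OF True submodule.m_closed[OF sub *(1,3)], of "c \<oplus>\<^bsub>K\<^esub> c'"] * by simp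
      next
        fix k x assume k: "k \<in> carrier K" and "x \<in> ?S w"
        then obtain h c where *: "h \<in> H w" "c \<in> carrier K" "x = h \<oplus>\<^bsub>fibre V w\<^esub> c \<odot>\<^bsub>fibre V w\<^esub> tmap V w u v"
          using SE[OF _ True] by meson
        then have "k \<odot>\<^bsub>fibre V w\<^esub> x = k \<odot>\<^bsub>fibre V w\<^esub> h \<oplus>\<^bsub>fibre V w\<^esub> (k \<otimes>\<^bsub>K\<^esub> c) \<odot>\<^bsub>fibre V w\<^esub> tmap V w u v"
          using car tv k by (simp add: fib.smult_r_distr fib.smult_assoc1)
        then show "k \<odot>\<^bsub>fibre V w\<^esub> x \<in> ?S w"
          using SI[OF True submodule.smult_closed[OF sub k *(1)], of "k \<otimes>\<^bsub>K\<^esub> c"] * k by simp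
      qed (rule fib.module_axioms)
    qed (use sub in simp)
    show "a w \<notin> ?S w"
      using avoid[OF w] avoiding_systemD(2)[OF sys w] by auto
  next
    fix w z x assume wz: "w \<in> U" "z \<in> U" "w \<le> z" and x: "x \<in> ?S w"
    note H = avoiding_systemD(3,4)[OF sys wz(1)]
    show "tmap V z w x \<in> ?S z"
    proof (cases "u \<le> w")
      case True
      then obtain h c where *: "h \<in> H w" "c \<in> carrier K" "x = h \<oplus>\<^bsub>fibre V w\<^esub> c \<odot>\<^bsub>fibre V w\<^esub> tmap V w u v"
        using SE[OF x] by meson
      then have "tmap V z w x = tmap V z w h \<oplus>\<^bsub>fibre V z\<^esub> c \<odot>\<^bsub>fibre V z\<^esub> tmap V z u v"
        using H(1) True wz v tmap_comp[OF True wz(3) v] by simp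
      then show ?thesis
        using SI[OF order_trans[OF True wz(3)] H(2)[OF wz(2,3) *(1)] *(2)] by simp
    next
      case False
      then have xH: "tmap V z w x \<in> H z" using x H(2)[OF wz(2,3)] by simp
      show ?thesis
      proof (cases "u \<le> z")
        case True
        then show ?thesis
          using SI[OF True xH, of "\<zero>\<^bsub>K\<^esub>"] avoiding_systemD(3)[OF sys wz(2) xH] v by simp
      qed (use xH in simp)
    qed
  }
qed

text \<open>
  A functional on the direct limit of the fibres over \<open>U\<close> that takes the value 1 on
  the common image of the vectors \<open>a u\<close>. In place of the limit, take a maximal
  avoiding system \<open>H\<close>, by Zorn's lemma. Being saturated and not extendable by a
  vector, it satisfies \<open>V\<^sub>u = H\<^sub>u \<oplus> K a\<^sub>u\<close> for every
  \<open>u\<close>, and \<open>f u v\<close> is the coefficient of \<open>a u\<close> in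
  \<open>v\<close>. These functionals are compatible because the structure maps carry
  \<open>H\<close> into \<open>H\<close> and \<open>a\<close> to \<open>a\<close>.
\<close>

lemma compatible_functionals:
  assumes a: "\<And>u. u \<in> U \<Longrightarrow> a u \<in> carrier (fibre V u)" "\<And>u. u \<in> U \<Longrightarrow> a u \<noteq> \<zero>\<^bsub>fibre V u\<^esub>"
    and compat: "\<And>u w. \<lbrakk>u \<in> U; w \<in> U; u \<le> w\<rbrakk> \<Longrightarrow> tmap V w u (a u) = a w"
  obtains f where "\<And>u. u \<in> U \<Longrightarrow> linear_functional K (fibre V u) (f u)"
    and "\<And>u. u \<in> U \<Longrightarrow> f u (a u) = \<one>\<^bsub>K\<^esub>"
    and "\<And>u w x. \<lbrakk>u \<in> U; w \<in> U; u \<le> w; x \<in> carrier (fibre V u)\<rbrakk> \<Longrightarrow> f w (tmap V w u x) = f u x"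
proof -
  let ?F = "{H. avoiding_system U a H}"
  have "\<exists>H\<in>?F. \<forall>H'\<in>?F. H \<le> H' \<longrightarrow> H' = H"
  proof (rule Zorn_maximal)
    have "avoiding_system U a (\<lambda>u. {\<zero>\<^bsub>fibre V u\<^esub>})"
      using a(2) by (simp add: avoiding_system_def submodule_zero)
    then show "?F \<noteq> {}" by (metis empty_iff mem_Collect_eq)
    fix \<H> assume \<H>: "\<H> \<subseteq> ?F" "\<H> \<noteq> {}" "\<And>x y. \<lbrakk>x \<in> \<H>; y \<in> \<H>\<rbrakk> \<Longrightarrow> x \<le> y \<or> y \<le> x"
    let ?Un = "\<lambda>u. \<Union>H\<in>\<H>. H u"
    have "H \<le> ?Un" if "H \<in> \<H>" for H using SUP_upper[OF that] by (intro le_funI)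
    moreover have "avoiding_system U a ?Un"
      using \<H> by (intro avoiding_system_Union) (simp_all add: subset_iff)
    ultimately show "\<exists>u\<in>?F. \<forall>x\<in>\<H>. x \<le> u" by (intro bexI[of _ ?Un] ballI CollectI)
  qed
  then obtain H where sys: "avoiding_system U a H"
    and max: "\<And>H'. \<lbrakk>avoiding_system U a H'; H \<le> H'\<rbrakk> \<Longrightarrow> H' = H"
    by (elim bexE) simp
  note sub = avoiding_systemD(1)[OF sys] and a_notin = avoiding_systemD(2)[OF sys]
    and car = avoiding_systemD(3)[OF sys]
  have saturated: "x \<in> H u"
    if "u \<in> U" "w \<in> U" "u \<le> w" "x \<in> carrier (fibre V u)" "tmap V w u x \<in> H w" for u w x
  proof -
    let ?S = "\<lambda>u. {x \<in> carrier (fibre V u). \<exists>w\<in>U. u \<le> w \<and> tmap V w u x \<in> H w}"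
    let ?H = "\<lambda>u. if u \<in> U then ?S u else H u"
    have "avoiding_system U a ?H"
      using avoiding_system_saturation[OF sys a(1) compat] by (simp add: avoiding_system_def)
    moreover have "H \<le> ?H"
    proof (rule le_funI)
      fix u
      have "x \<in> ?S u" if "u \<in> U" "x \<in> H u" for x
        using that car[OF that] by (auto intro!: bexI[of _ u] simp: tmap_id)
      then show "H u \<le> ?H u" by auto
    qed
    ultimately have "?H u = H u" by (intro fun_cong[of ?H H] max)
    moreover have "x \<in> ?H u" using that by auto
    ultimately show ?thesis by simp
  qed
  \<comment> \<open>maximality: \<open>H u\<close> and \<open>a u\<close> span the fibre at \<open>u\<close>\<close>
  have ex: "\<exists>c. c \<in> carrier K \<and> v \<ominus>\<^bsub>fibre V u\<^esub> c \<odot>\<^bsub>fibre V u\<^esub> a u \<in> H u"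
    if u: "u \<in> U" and v: "v \<in> carrier (fibre V u)" for u v
  proof (cases "v \<in> H u")
    case True
    then show ?thesis
      using u a(1) fib.submodule_minus[OF sub[OF u] _ submodule.zero_closed[OF sub[OF u]]]
      by (intro exI[of _ "\<zero>\<^bsub>K\<^esub>"]) simp
  next
    case False
    \<comment> \<open>otherwise \<open>v\<close> and its images could be added to \<open>H\<close>\<close>
    have "\<exists>w h c. w \<in> U \<and> u \<le> w \<and> h \<in> H w \<and> c \<in> carrier K \<and>
        a w = h \<oplus>\<^bsub>fibre V w\<^esub> c \<odot>\<^bsub>fibre V w\<^esub> tmap V w u v"
    proof (rule ccontr)
      assume no: "\<not> ?thesis"
      let ?T = "\<lambda>w. {h \<oplus>\<^bsub>fibre V w\<^esub> c \<odot>\<^bsub>fibre V w\<^esub> tmap V w u v | h c. h \<in> H w \<and> c \<in> carrier K}"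
      let ?S = "\<lambda>w. if u \<le> w then ?T w else H w"
      let ?H = "\<lambda>w. if w \<in> U then ?S w else H w"
      have "avoiding_system U a ?S"
        by (rule avoiding_system_add_vector[OF sys u v]) (use no in blast)
      then have "avoiding_system U a ?H" by (simp add: avoiding_system_def)
      moreover have "H \<le> ?H"
      proof (rule le_funI)
        fix w
        have "h \<in> ?T w" if "w \<in> U" "u \<le> w" "h \<in> H w" for h
        proof -
          have "h = h \<oplus>\<^bsub>fibre V w\<^esub> \<zero>\<^bsub>K\<^esub> \<odot>\<^bsub>fibre V w\<^esub> tmap V w u v"
            using car[OF that(1,3)] that(2) v by simp
          with that(3) show ?thesis by auto
        qed
        then show "H w \<le> ?H w" by auto
      qed
      ultimately have "?H u = H u" by (intro fun_cong[of ?H H] max)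
      moreover have "v = \<zero>\<^bsub>fibre V u\<^esub> \<oplus>\<^bsub>fibre V u\<^esub> \<one>\<^bsub>K\<^esub> \<odot>\<^bsub>fibre V u\<^esub> tmap V u u v"
        using v by (simp add: tmap_id)
      then have "v \<in> ?T u" using submodule.zero_closed[OF sub[OF u]] by auto
      ultimately show False using u False by simp
    qed
    then obtain w h c where w: "w \<in> U" "u \<le> w" and h: "h \<in> H w" and c: "c \<in> carrier K"
      and aw: "a w = h \<oplus>\<^bsub>fibre V w\<^esub> c \<odot>\<^bsub>fibre V w\<^esub> tmap V w u v" by (elim exE conjE)
    have tv: "tmap V w u v \<in> carrier (fibre V w)" using w v by simp
    have hc: "h \<in> carrier (fibre V w)" using car[OF w(1) h] .
    have "c \<noteq> \<zero>\<^bsub>K\<^esub>"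
    proof
      assume "c = \<zero>\<^bsub>K\<^esub>"
      then have "a w = h" using aw tv hc by simp
      with h a_notin[OF w(1)] show False by simp
    qed
    with c obtain d where d: "d \<in> carrier K" "d \<otimes>\<^bsub>K\<^esub> c = \<one>\<^bsub>K\<^esub>" by (rule fib.exists_inverse)
    let ?x = "v \<ominus>\<^bsub>fibre V u\<^esub> d \<odot>\<^bsub>fibre V u\<^esub> a u"
    have "d \<odot>\<^bsub>fibre V w\<^esub> a w = d \<odot>\<^bsub>fibre V w\<^esub> h \<oplus>\<^bsub>fibre V w\<^esub> tmap V w u v"
      unfolding aw using hc tv c d by (simp add: fib.smult_r_distr fib.smult_assoc1[symmetric])
    moreover have "tmap V w u ?x = tmap V w u v \<ominus>\<^bsub>fibre V w\<^esub> d \<odot>\<^bsub>fibre V w\<^esub> a w"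
      using w u v d a(1) compat[OF u w] by simp
    ultimately have "tmap V w u ?x = \<zero>\<^bsub>fibre V w\<^esub> \<ominus>\<^bsub>fibre V w\<^esub> d \<odot>\<^bsub>fibre V w\<^esub> h"
      using hc tv d fib.M.r_neg[OF tv]
      by (simp add: a_minus_def fib.M.minus_add fib.M.a_ac(3)[of "tmap V w u v"])
    then have "tmap V w u ?x \<in> H w"
      using fib.submodule_minus[OF sub[OF w(1)] submodule.zero_closed[OF sub[OF w(1)]]
        submodule.smult_closed[OF sub[OF w(1)] d(1) h]] by simp
    then have "?x \<in> H u"
      using saturated[OF u w, of ?x] v d a(1)[OF u] by simp
    with d show ?thesis by auto
  qed
  have uniq: "c = d"
    if u: "u \<in> U" and v: "v \<in> carrier (fibre V u)" and c: "c \<in> carrier K" and d: "d \<in> carrier K"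
      and "v \<ominus>\<^bsub>fibre V u\<^esub> c \<odot>\<^bsub>fibre V u\<^esub> a u \<in> H u" "v \<ominus>\<^bsub>fibre V u\<^esub> d \<odot>\<^bsub>fibre V u\<^esub> a u \<in> H u" for u v c d
  proof (rule ccontr)
    assume "c \<noteq> d"
    then have ne: "d \<ominus>\<^bsub>K\<^esub> c \<noteq> \<zero>\<^bsub>K\<^esub>" using c d by simp
    let ?ca = "c \<odot>\<^bsub>fibre V u\<^esub> a u" and ?da = "d \<odot>\<^bsub>fibre V u\<^esub> a u"
    have ca: "?ca \<in> carrier (fibre V u)" "?da \<in> carrier (fibre V u)" using c d a(1) u by simp_all
    have "(v \<ominus>\<^bsub>fibre V u\<^esub> ?ca) \<ominus>\<^bsub>fibre V u\<^esub> (v \<ominus>\<^bsub>fibre V u\<^esub> ?da) \<in> H u"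
      using fib.submodule_minus[OF sub[OF u]] that(5,6) .
    also have "(v \<ominus>\<^bsub>fibre V u\<^esub> ?ca) \<ominus>\<^bsub>fibre V u\<^esub> (v \<ominus>\<^bsub>fibre V u\<^esub> ?da) = ?da \<ominus>\<^bsub>fibre V u\<^esub> ?ca"
      using fib.minus_minus_cancel_left[OF v ca] .
    also have "\<dots> = (d \<ominus>\<^bsub>K\<^esub> c) \<odot>\<^bsub>fibre V u\<^esub> a u"
      using c d a(1)[OF u] by (simp add: a_minus_def fib.smult_l_distr fib.smult_l_minus)
    finally show False
      using fib.submodule_smult_cancel[OF sub[OF u] _ ne a(1)[OF u]] a_notin[OF u] c d by simp
  qed
  define f where "f u v = (THE c. c \<in> carrier K \<and> v \<ominus>\<^bsub>fibre V u\<^esub> c \<odot>\<^bsub>fibre V u\<^esub> a u \<in> H u)" for u v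
  have f: "f u v \<in> carrier K \<and> v \<ominus>\<^bsub>fibre V u\<^esub> f u v \<odot>\<^bsub>fibre V u\<^esub> a u \<in> H u"
    if "u \<in> U" "v \<in> carrier (fibre V u)" for u v
    unfolding f_def using ex[OF that] by (rule theI'[OF ex_ex1I]) (use uniq[OF that] in simp)
  have f_eqI: "f u v = c"
    if "u \<in> U" "v \<in> carrier (fibre V u)" "c \<in> carrier K" "v \<ominus>\<^bsub>fibre V u\<^esub> c \<odot>\<^bsub>fibre V u\<^esub> a u \<in> H u" for u v c
    using uniq[OF that(1,2) _ that(3) _ that(4)] f[OF that(1,2)] by simp
  show thesis
  proof (rule that)
    fix u assume u: "u \<in> U"
    note fu = f[OF u, THEN conjunct1] f[OF u, THEN conjunct2] and au = a(1)[OF u]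
    show "f u (a u) = \<one>\<^bsub>K\<^esub>"
      using f_eqI[OF u au, of "\<one>\<^bsub>K\<^esub>"] fib.M.r_neg[OF au] submodule.zero_closed[OF sub[OF u]] au
      by (simp add: a_minus_def)
    show "linear_functional K (fibre V u) (f u)"
      unfolding linear_functional_def
    proof (intro conjI ballI)
      fix x assume x: "x \<in> carrier (fibre V u)"
      show "f u x \<in> carrier K" using fu(1)[OF x] .
      fix y assume y: "y \<in> carrier (fibre V u)"
      have "(x \<ominus>\<^bsub>fibre V u\<^esub> f u x \<odot>\<^bsub>fibre V u\<^esub> a u) \<oplus>\<^bsub>fibre V u\<^esub> (y \<ominus>\<^bsub>fibre V u\<^esub> f u y \<odot>\<^bsub>fibre V u\<^esub> a u)
        = (x \<oplus>\<^bsub>fibre V u\<^esub> y) \<ominus>\<^bsub>fibre V u\<^esub> (f u x \<oplus>\<^bsub>K\<^esub> f u y) \<odot>\<^bsub>fibre V u\<^esub> a u"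
        using x y fu(1)[OF x] fu(1)[OF y] au
        by (simp add: a_minus_def fib.smult_l_distr fib.M.minus_add fib.M.a_ac)
      then show "f u (x \<oplus>\<^bsub>fibre V u\<^esub> y) = f u x \<oplus>\<^bsub>K\<^esub> f u y"
        using submodule.m_closed[OF sub[OF u] fu(2)[OF x] fu(2)[OF y]] x y fu(1)[OF x] fu(1)[OF y]
        by (intro f_eqI[OF u]) simp_all
    next
      fix c x assume c: "c \<in> carrier K" and x: "x \<in> carrier (fibre V u)"
      have "c \<odot>\<^bsub>fibre V u\<^esub> (x \<ominus>\<^bsub>fibre V u\<^esub> f u x \<odot>\<^bsub>fibre V u\<^esub> a u)
        = c \<odot>\<^bsub>fibre V u\<^esub> x \<ominus>\<^bsub>fibre V u\<^esub> (c \<otimes>\<^bsub>K\<^esub> f u x) \<odot>\<^bsub>fibre V u\<^esub> a u"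
        using x c fu(1)[OF x] au
        by (simp add: a_minus_def fib.smult_r_distr fib.smult_r_minus fib.smult_assoc1)
      then show "f u (c \<odot>\<^bsub>fibre V u\<^esub> x) = c \<otimes>\<^bsub>K\<^esub> f u x"
        using submodule.smult_closed[OF sub[OF u] c fu(2)[OF x]] x c fu(1)[OF x]
        by (intro f_eqI[OF u]) simp_all
    qed
  next
    fix u w x assume u: "u \<in> U" and w: "w \<in> U" "u \<le> w" and x: "x \<in> carrier (fibre V u)"
    have "tmap V w u (x \<ominus>\<^bsub>fibre V u\<^esub> f u x \<odot>\<^bsub>fibre V u\<^esub> a u)
      = tmap V w u x \<ominus>\<^bsub>fibre V w\<^esub> f u x \<odot>\<^bsub>fibre V w\<^esub> a w"
      using x f[OF u x] a(1)[OF u] w compat[OF u w] by simp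
    then show "f w (tmap V w u x) = f u x"
      using avoiding_systemD(4)[OF sys u w, of "x \<ominus>\<^bsub>fibre V u\<^esub> f u x \<odot>\<^bsub>fibre V u\<^esub> a u"] f[OF u x] x w
      by (intro f_eqI[OF w(1)]) simp_all
  qed
qed

end

section \<open>Existence of an interval summand\<close>

context persistence_module
begin

text \<open>
  An interval summand of \<open>V\<close>, given by its inclusion and its projection. The vectors
  \<open>a t\<close> form a morphism from the interval module on the support of \<open>a\<close>
  to \<open>V\<close>, the functionals \<open>f t\<close> form a morphism back, and the composite
  \<open>f t (a t) = \<one>\<^bsub>K\<^esub>\<close> on the support is the identity. The two
  conditions on structure maps cover the ends of the interval: \<open>a t\<close> is zero above
  it, so \<open>a s\<close> must die there, and \<open>f s\<close> is zero below it, so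
  \<open>f t\<close> must kill what comes from there. That the support is an interval then
  follows.
\<close>

definition split_bar :: "('r \<Rightarrow> 'v) \<Rightarrow> ('r \<Rightarrow> 'v \<Rightarrow> 'a) \<Rightarrow> bool"
  where "split_bar a f \<longleftrightarrow>
    (\<forall>t. a t \<in> carrier (fibre V t)) \<and>
    (\<forall>t. linear_functional K (fibre V t) (f t)) \<and>
    (\<forall>t. a t \<noteq> \<zero>\<^bsub>fibre V t\<^esub> \<longrightarrow> f t (a t) = \<one>\<^bsub>K\<^esub>) \<and>
    (\<forall>t. a t = \<zero>\<^bsub>fibre V t\<^esub> \<longrightarrow> (\<forall>x\<in>carrier (fibre V t). f t x = \<zero>\<^bsub>K\<^esub>)) \<and>
    (\<forall>s t. s \<le> t \<longrightarrow> a s \<noteq> \<zero>\<^bsub>fibre V s\<^esub> \<longrightarrow> tmap V t s (a s) = a t) \<and>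
    (\<forall>s t. s \<le> t \<longrightarrow> a t \<noteq> \<zero>\<^bsub>fibre V t\<^esub> \<longrightarrow>
      (\<forall>x\<in>carrier (fibre V s). f t (tmap V t s x) = f s x))"

definition support :: "('r \<Rightarrow> 'v) \<Rightarrow> 'r set"
  where "support a = {t. a t \<noteq> \<zero>\<^bsub>fibre V t\<^esub>}"

lemma split_barD:
  assumes "split_bar a f"
  shows "a t \<in> carrier (fibre V t)" "linear_functional K (fibre V t) (f t)"
    "t \<in> support a \<Longrightarrow> f t (a t) = \<one>\<^bsub>K\<^esub>"
    "\<lbrakk>t \<notin> support a; x \<in> carrier (fibre V t)\<rbrakk> \<Longrightarrow> f t x = \<zero>\<^bsub>K\<^esub>"
    "\<lbrakk>s \<le> t; s \<in> support a\<rbrakk> \<Longrightarrow> tmap V t s (a s) = a t"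
    "\<lbrakk>s \<le> t; t \<in> support a; x \<in> carrier (fibre V s)\<rbrakk> \<Longrightarrow> f t (tmap V t s x) = f s x"
  using assms unfolding split_bar_def support_def mem_Collect_eq by meson+

lemma order_interval_support:
  assumes "split_bar a f" "support a \<noteq> {}"
  shows "order_interval (support a)"
  unfolding order_interval_def
proof (intro conjI allI impI)
  fix r s t assume *: "r \<in> support a \<and> t \<in> support a \<and> r \<le> s \<and> s \<le> t"
  have "tmap V t s (a s) = tmap V t s (tmap V s r (a r))"
    using split_barD(5)[OF assms(1), of r s] * by simp
  also have "\<dots> = tmap V t r (a r)"
    using tmap_comp * split_barD(1)[OF assms(1)] by simp
  also have "\<dots> = a t"
    using split_barD(5)[OF assms(1), of r t] * order_trans[of r s t] by simp
  finally have "tmap V t s (a s) \<noteq> \<zero>\<^bsub>fibre V t\<^esub>"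
    using * by (simp add: support_def)
  then show "s \<in> support a"
    using * by (auto simp: support_def)
qed (rule assms)

lemma submodule_image_tmap:
  assumes "s \<le> t"
  shows "submodule K (tmap V t s ` carrier (fibre V s)) (fibre V t)"
  using mod_hom.im_is_submodule[OF tmap_hom[OF assms]] by (simp add: mod_hom.im_def[OF tmap_hom[OF assms]])

end

context artinian_persistence_module
begin

text \<open>
  The images of the maps into the fibre at \<open>t\<close> form a chain of subspaces; any nonzero
  element of the smallest nonzero one lies in all the nonzero ones.
\<close>

lemma exists_stable_image_element:
  assumes "x \<in> carrier (fibre V t)" "x \<noteq> \<zero>\<^bsub>fibre V t\<^esub>"
  obtains a where "a \<in> carrier (fibre V t)" "a \<noteq> \<zero>\<^bsub>fibre V t\<^esub>"
    "\<And>s y. \<lbrakk>s \<le> t; y \<in> carrier (fibre V s); tmap V t s y \<noteq> \<zero>\<^bsub>fibre V t\<^esub>\<rbrakk>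
      \<Longrightarrow> a \<in> tmap V t s ` carrier (fibre V s)"
proof -
  let ?Im = "\<lambda>s. tmap V t s ` carrier (fibre V s)"
  let ?\<W> = "{?Im s | s. s \<le> t \<and> (\<exists>w\<in>?Im s. w \<noteq> \<zero>\<^bsub>fibre V t\<^esub>)}"
  have "x \<in> ?Im t" using assms(1) tmap_id[OF assms(1)] by (metis imageI)
  then have "?Im t \<in> ?\<W>" using assms(2) by blast
  then have ne: "?\<W> \<noteq> {}" by (metis (no_types) empty_iff)
  have "\<forall>W\<in>?\<W>. submodule K W (fibre V t)" using submodule_image_tmap by blast
  with ne obtain W where W: "W \<in> ?\<W>" and min: "\<And>W'. \<lbrakk>W' \<in> ?\<W>; W' \<subseteq> W\<rbrakk> \<Longrightarrow> W' = W"
    using artinian_fibre[unfolded fib.artinian_def, rule_format, of ?\<W>] by meson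
  then obtain q where q: "q \<le> t" "W = ?Im q" by (elim CollectE exE conjE)
  from W obtain a where a: "a \<in> W" "a \<noteq> \<zero>\<^bsub>fibre V t\<^esub>" by (elim CollectE exE conjE bexE) simp
  have sub: "?Im r \<subseteq> ?Im s" if "r \<le> s" "s \<le> t" for r s
  proof (rule image_subsetI)
    fix y assume "y \<in> carrier (fibre V r)"
    then have "tmap V t r y = tmap V t s (tmap V s r y)" "tmap V s r y \<in> carrier (fibre V s)"
      using tmap_comp that by simp_all
    then show "tmap V t r y \<in> ?Im s" by simp
  qed
  show thesis
  proof (rule that[OF _ a(2)])
    show "a \<in> carrier (fibre V t)" using a q by auto
    fix s y assume s: "s \<le> t" and y: "y \<in> carrier (fibre V s)" "tmap V t s y \<noteq> \<zero>\<^bsub>fibre V t\<^esub>"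
    show "a \<in> ?Im s"
    proof (cases "s \<le> q")
      case True
      have "?Im s \<in> ?\<W>" using s y by blast
      then have "?Im s = W" using sub[OF True q(1)] q(2) min by simp
      with a show ?thesis by simp
    next
      case False
      then have "?Im q \<subseteq> ?Im s" using sub s by simp
      with a q show ?thesis by auto
    qed
  qed
qed

text \<open>
  A nonzero fibre at \<open>t\<close> gives an interval summand whose support contains
  \<open>t\<close>. Let \<open>e\<close> be a nonzero element of the smallest nonzero image in the
  fibre at \<open>t\<close>. Below \<open>t\<close> the interval is the set \<open>S\<close> of
  indices from which some vector survives to \<open>t\<close>, above \<open>t\<close> the set
  \<open>U\<close> of those up to which \<open>e\<close> survives. The preimages of
  \<open>e\<close> over \<open>S\<close> form an affine system, whose limit supplies
  \<open>a\<close> below \<open>t\<close>. Over \<open>U\<close> there are compatible functionals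
  with value 1 on the images of \<open>e\<close>; below \<open>t\<close>, compose the one at
  \<open>t\<close> with the structure maps. It kills all vectors from below \<open>S\<close>
  because these are zero by the time they reach \<open>t\<close>.
\<close>

lemma exists_split_bar:
  assumes "x \<in> carrier (fibre V t)" "x \<noteq> \<zero>\<^bsub>fibre V t\<^esub>"
  obtains a f where "split_bar a f" "t \<in> support a"
proof -
  obtain e where e: "e \<in> carrier (fibre V t)" "e \<noteq> \<zero>\<^bsub>fibre V t\<^esub>"
    and e_im: "\<And>s y. \<lbrakk>s \<le> t; y \<in> carrier (fibre V s); tmap V t s y \<noteq> \<zero>\<^bsub>fibre V t\<^esub>\<rbrakk>
      \<Longrightarrow> e \<in> tmap V t s ` carrier (fibre V s)"
    using exists_stable_image_element[OF assms] by metis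
  define S where "S = {s. s \<le> t \<and> (\<exists>y\<in>carrier (fibre V s). tmap V t s y \<noteq> \<zero>\<^bsub>fibre V t\<^esub>)}"
  define U where "U = {u. t \<le> u \<and> tmap V u t e \<noteq> \<zero>\<^bsub>fibre V u\<^esub>}"
  have S_le: "s \<le> t" if "s \<in> S" for s using that by (simp add: S_def)
  have t: "t \<in> S" "t \<in> U" using e tmap_id[OF e(1)] by (auto simp: S_def U_def intro!: bexI[of _ e])
  have "affine_system S (\<lambda>s. {y \<in> carrier (fibre V s). tmap V t s y = e})"
    unfolding affine_system_def
  proof (intro conjI ballI impI)
    fix s assume s: "s \<in> S"
    have "fib.affine_subset s (carrier (fibre V s))" by (simp add: fib.affine_subset_def)
    then show "fib.affine_subset s {y \<in> carrier (fibre V s). tmap V t s y = e}"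
      by (rule affine_subset_fibre_tmap[OF S_le[OF s] _ e(1)])
    have "e \<in> tmap V t s ` carrier (fibre V s)"
      using s e_im unfolding S_def by blast
    then show "{y \<in> carrier (fibre V s). tmap V t s y = e} \<noteq> {}" by auto
  next
    fix r s assume rs: "r \<in> S" "s \<in> S" "r \<le> s"
    show "tmap V s r ` {y \<in> carrier (fibre V r). tmap V t r y = e}
      \<subseteq> {y \<in> carrier (fibre V s). tmap V t s y = e}"
      using rs tmap_comp[OF rs(3) S_le[OF rs(2)]] by auto
  qed
  from compatible_choice[OF this] obtain b where
    b': "\<And>s. s \<in> S \<Longrightarrow> b s \<in> {y \<in> carrier (fibre V s). tmap V t s y = e}"
    and b_compat: "\<And>r s. \<lbrakk>r \<in> S; s \<in> S; r \<le> s\<rbrakk> \<Longrightarrow> tmap V s r (b r) = b s" by blast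
  have b: "b s \<in> carrier (fibre V s)" "tmap V t s (b s) = e" if "s \<in> S" for s
    using b'[OF that] by simp_all
  have u_e: "tmap V u t e \<in> carrier (fibre V u)" "tmap V u t e \<noteq> \<zero>\<^bsub>fibre V u\<^esub>" if "u \<in> U" for u
    using that e by (simp_all add: U_def)
  have comp_e: "tmap V w u (tmap V u t e) = tmap V w t e" if "t \<le> u" "u \<le> w" for u w
    using tmap_comp[OF that e(1)] .
  have e_compat: "tmap V w u (tmap V u t e) = tmap V w t e" if "u \<in> U" "w \<in> U" "u \<le> w" for u w
    using comp_e that by (simp add: U_def)
  obtain g where g: "\<And>u. u \<in> U \<Longrightarrow> linear_functional K (fibre V u) (g u)"
    "\<And>u. u \<in> U \<Longrightarrow> g u (tmap V u t e) = \<one>\<^bsub>K\<^esub>"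
    "\<And>u w x. \<lbrakk>u \<in> U; w \<in> U; u \<le> w; x \<in> carrier (fibre V u)\<rbrakk> \<Longrightarrow> g w (tmap V w u x) = g u x"
    by (rule compatible_functionals[of U "\<lambda>u. tmap V u t e", OF u_e e_compat]; blast)
  define a where "a s = (if s \<le> t then if s \<in> S then b s else \<zero>\<^bsub>fibre V s\<^esub> else tmap V s t e)" for s
  define f where "f s = (if s \<in> S then (\<lambda>x. g t (tmap V t s x)) else if s \<in> U then g s else (\<lambda>x. \<zero>\<^bsub>K\<^esub>))" for s
  have b_nz: "b s \<noteq> \<zero>\<^bsub>fibre V s\<^esub>" if "s \<in> S" for s
    using b[OF that] e S_le[OF that] by auto
  have a_nz: "a s \<noteq> \<zero>\<^bsub>fibre V s\<^esub> \<longleftrightarrow> s \<in> S \<or> s \<in> U \<and> t < s" for s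
    using b_nz[of s] S_le[of s] by (auto simp: a_def U_def)
  have "split_bar a f"
    unfolding split_bar_def
  proof (intro conjI allI impI ballI)
    fix s
    show "a s \<in> carrier (fibre V s)" using b e by (auto simp: a_def)
    show "linear_functional K (fibre V s) (f s)"
    proof (cases "s \<in> S")
      case True
      then show ?thesis
        using linear_functionalD[OF g(1)[OF t(2)]] S_le[OF True]
        by (simp add: f_def linear_functional_def)
    next
      case False
      then show ?thesis
        using g(1)[of s] by (simp add: f_def linear_functional_def)
    qed
    show "f s (a s) = \<one>\<^bsub>K\<^esub>" if "a s \<noteq> \<zero>\<^bsub>fibre V s\<^esub>"
      using that g(2)[of s] g(2)[OF t(2)] b(2)[of s] tmap_id[OF e(1)] S_le[of s]
      unfolding a_nz by (auto simp: a_def f_def)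
    show "f s x = \<zero>\<^bsub>K\<^esub>" if "a s = \<zero>\<^bsub>fibre V s\<^esub>" "x \<in> carrier (fibre V s)" for x
      using that a_nz[of s] t(1) by (auto simp: f_def U_def)
    fix s'
    assume le: "s \<le> s'"
    show "tmap V s' s (a s) = a s'" if "a s \<noteq> \<zero>\<^bsub>fibre V s\<^esub>"
    proof (cases "s \<in> S")
      case True
      show ?thesis
      proof (cases "s' \<le> t")
        case True
        have "tmap V t s' (tmap V s' s (b s)) = e"
          using tmap_comp[OF le True] b[OF \<open>s \<in> S\<close>] by simp
        then have "s' \<in> S"
          using e b[OF \<open>s \<in> S\<close>] True le by (auto simp: S_def intro!: bexI[of _ "tmap V s' s (b s)"])
        then show ?thesis using b_compat \<open>s \<in> S\<close> le True by (simp add: a_def S_le)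
      next
        case False
        then show ?thesis
          using \<open>s \<in> S\<close> S_le tmap_comp[of s t s' "b s"] b[OF \<open>s \<in> S\<close>] by (simp add: a_def)
      qed
    next
      case False
      with that a_nz have "t < s" by auto
      then have "\<not> s \<le> t" "\<not> s' \<le> t" "t \<le> s" using le by auto
      then show ?thesis using le comp_e[of s s'] by (simp add: a_def)
    qed
    fix x
    assume nz: "a s' \<noteq> \<zero>\<^bsub>fibre V s'\<^esub>" and x: "x \<in> carrier (fibre V s)"
    have gt: "g t (tmap V t s x) = f s x" if "s \<le> t"
    proof (cases "s \<in> S")
      case False
      with that x have "tmap V t s x = \<zero>\<^bsub>fibre V t\<^esub>" by (auto simp: S_def)
      moreover have "f s x = \<zero>\<^bsub>K\<^esub>"
        using False t(1) that by (auto simp: f_def U_def)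
      ultimately show ?thesis
        using fib.linear_functional_zero[OF g(1)[OF t(2)]] by simp
    qed (simp add: f_def)
    show "f s' (tmap V s' s x) = f s x"
    proof (cases "s' \<in> S")
      case True
      then have "f s' (tmap V s' s x) = g t (tmap V t s x)"
        using tmap_comp[OF le S_le[OF True] x] by (simp add: f_def)
      with gt S_le[OF True] le show ?thesis by simp
    next
      case False
      with nz a_nz have s': "s' \<in> U" "t < s'" by auto
      show ?thesis
      proof (cases "s \<le> t")
        case True
        have "f s' (tmap V s' s x) = g s' (tmap V s' t (tmap V t s x))"
          using False s' tmap_comp[OF True _ x, of s'] by (simp add: f_def)
        also have "\<dots> = g t (tmap V t s x)"
          using g(3)[OF t(2) s'(1)] s'(2) True x by simp
        finally show ?thesis using gt[OF True] by simp
      next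
        case out: False
        have "tmap V s' s (tmap V s t e) \<noteq> \<zero>\<^bsub>fibre V s'\<^esub>"
          using comp_e[of s s'] s' le out by (simp add: U_def)
        then have "s \<in> U" using le out e by (auto simp: U_def)
        then show ?thesis
          using g(3)[OF _ s'(1) le x] out False s' S_le[of s] by (auto simp: f_def)
      qed
    qed
  qed
  moreover have "t \<in> support a" using a_nz[of t] t by (simp add: support_def)
  ultimately show thesis by (rule that)
qed

end

section \<open>Complete biorthogonal families of interval summands\<close>

definition restrict_pers :: "('r, 'a, 'v) pers_mod \<Rightarrow> ('r \<Rightarrow> 'v set) \<Rightarrow> ('r, 'a, 'v) pers_mod"
  where "restrict_pers V C = \<lparr>fibre = \<lambda>t. (fibre V t)\<lparr>carrier := C t\<rparr>, tmap = tmap V\<rparr>"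

lemma restrict_pers_simps [simp]:
  "fibre (restrict_pers V C) t = (fibre V t)\<lparr>carrier := C t\<rparr>"
  "tmap (restrict_pers V C) = tmap V"
  by (simp_all add: restrict_pers_def)

lemma (in persistence_module) persistence_module_restrict_pers:
  assumes C: "\<And>t. submodule K (C t) (fibre V t)"
    and inv: "\<And>s t x. \<lbrakk>s \<le> t; x \<in> C s\<rbrakk> \<Longrightarrow> tmap V t s x \<in> C t"
  shows "persistence_module K (restrict_pers V C)"
proof (rule persistence_module.intro)
  have car: "x \<in> carrier (fibre V t)" if "x \<in> C t" for x t
    using submodule.subset[OF C] that by auto
  show vs: "vectorspace K (fibre (restrict_pers V C) t)" for t
    using fib.submodule_is_module[OF C] fib.field_axioms by (simp add: vectorspace_def)
  show "linear_map K (fibre (restrict_pers V C) s) (fibre (restrict_pers V C) t) (tmap (restrict_pers V C) t s)"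
    if "s \<le> t" for s t
  proof -
    have "mod_hom_axioms K (fibre (restrict_pers V C) s) (fibre (restrict_pers V C) t) (tmap (restrict_pers V C) t s)"
      using inv[OF that] that by (auto simp: mod_hom_axioms_def module_hom_def car)
    with vs show ?thesis by (simp add: linear_map_def mod_hom_def vectorspace_def)
  qed
  show "tmap (restrict_pers V C) t s (tmap (restrict_pers V C) s r x) = tmap (restrict_pers V C) t r x"
    if "r \<le> s" "s \<le> t" "x \<in> carrier (fibre (restrict_pers V C) r)" for r s t x
    using tmap_comp[OF that(1,2)] that(3) car by simp
  show "tmap (restrict_pers V C) t t x = x" if "x \<in> carrier (fibre (restrict_pers V C) t)" for t x
    using that car tmap_id by simp
qed

lemma (in artinian_persistence_module) artinian_persistence_module_restrict_pers:
  assumes C: "\<And>t. submodule K (C t) (fibre V t)"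
    and inv: "\<And>s t x. \<lbrakk>s \<le> t; x \<in> C s\<rbrakk> \<Longrightarrow> tmap V t s x \<in> C t"
  shows "artinian_persistence_module K (restrict_pers V C)"
proof -
  interpret W: persistence_module K "restrict_pers V C"
    by (rule persistence_module_restrict_pers[OF C inv])
  have sub: "submodule K N (fibre V t)" if N: "submodule K N (fibre (restrict_pers V C) t)" for N t
  proof (rule submodule.intro)
    have "N \<subseteq> C t" using submodule.subset[OF N] by simp
    then show "N \<subseteq> carrier (fibre V t)" using submodule.subset[OF C] by (rule subset_trans)
    show "\<zero>\<^bsub>fibre V t\<^esub> \<in> N" using submodule.zero_closed[OF N] by simp
    show "v \<oplus>\<^bsub>fibre V t\<^esub> w \<in> N" if "v \<in> N" "w \<in> N" for v w
      using submodule.m_closed[OF N that] by simp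
    show "c \<odot>\<^bsub>fibre V t\<^esub> v \<in> N" if "c \<in> carrier K" "v \<in> N" for c v
      using submodule.smult_closed[OF N that] by simp
  qed (rule fib.module_axioms)
  show ?thesis
  proof (unfold_locales)
    show "W.fib.artinian t" for t
      unfolding W.fib.artinian_def using sub artinian_fibre[of t, unfolded fib.artinian_def] by meson
  qed
qed

type_synonym ('r, 'a, 'v) bar = "('r \<Rightarrow> 'v) \<times> ('r \<Rightarrow> 'v \<Rightarrow> 'a)"

context persistence_module
begin

text \<open>
  Distinct bars annihilate each other in both orders, so the projections onto the corresponding
  summands are orthogonal idempotents. All conditions involve at most two bars at a time, so
  biorthogonality passes to unions of chains.
\<close>

definition biorthogonal :: "('r, 'a, 'v) bar set \<Rightarrow> bool"
  where "biorthogonal X \<longleftrightarrow>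
    (\<forall>b\<in>X. split_bar (fst b) (snd b) \<and> support (fst b) \<noteq> {}) \<and>
    (\<forall>b\<in>X. \<forall>b'\<in>X. b \<noteq> b' \<longrightarrow> (\<forall>t. snd b t (fst b' t) = \<zero>\<^bsub>K\<^esub>))"

definition bars_at :: "('r, 'a, 'v) bar set \<Rightarrow> 'r \<Rightarrow> ('r, 'a, 'v) bar set"
  where "bars_at X t = {b \<in> X. t \<in> support (fst b)}"

text \<open>
  The complement in \<open>V\<close> of the summands given by the bars in \<open>X\<close>.
\<close>

definition common_kernel :: "('r, 'a, 'v) bar set \<Rightarrow> 'r \<Rightarrow> 'v set"
  where "common_kernel X t = {v \<in> carrier (fibre V t). \<forall>b\<in>X. snd b t v = \<zero>\<^bsub>K\<^esub>}"

definition expansion :: "('r, 'a, 'v) bar set \<Rightarrow> 'r \<Rightarrow> 'v \<Rightarrow> 'v"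
  where "expansion F t v = (\<Oplus>\<^bsub>fibre V t\<^esub>b\<in>F. snd b t v \<odot>\<^bsub>fibre V t\<^esub> fst b t)"

lemma bars_at_subset: "bars_at X t \<subseteq> X"
  by (auto simp: bars_at_def)

lemma biorthogonalD:
  assumes "biorthogonal X"
  shows "b \<in> X \<Longrightarrow> split_bar (fst b) (snd b)" "b \<in> X \<Longrightarrow> support (fst b) \<noteq> {}"
    "\<lbrakk>b \<in> X; b' \<in> X; b \<noteq> b'\<rbrakk> \<Longrightarrow> snd b t (fst b' t) = \<zero>\<^bsub>K\<^esub>"
  using assms unfolding biorthogonal_def by blast+

lemma submodule_common_kernel:
  assumes "\<And>b. b \<in> X \<Longrightarrow> linear_functional K (fibre V t) (snd b t)"
  shows "submodule K (common_kernel X t) (fibre V t)"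
proof (rule submodule.intro)
  note lin = linear_functionalD[OF assms] fib.linear_functional_zero[OF assms]
  show "common_kernel X t \<subseteq> carrier (fibre V t)" by (auto simp: common_kernel_def)
  show "\<zero>\<^bsub>fibre V t\<^esub> \<in> common_kernel X t" by (simp add: common_kernel_def lin)
  show "v \<oplus>\<^bsub>fibre V t\<^esub> w \<in> common_kernel X t"
    if "v \<in> common_kernel X t" "w \<in> common_kernel X t" for v w
    using that by (simp add: common_kernel_def lin)
  show "c \<odot>\<^bsub>fibre V t\<^esub> v \<in> common_kernel X t"
    if "c \<in> carrier K" "v \<in> common_kernel X t" for c v
    using that by (simp add: common_kernel_def lin)
qed (rule fib.module_axioms)

lemma tmap_common_kernel:
  assumes X: "\<And>b. b \<in> X \<Longrightarrow> split_bar (fst b) (snd b)"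
    and st: "s \<le> t" and v: "v \<in> common_kernel X s"
  shows "tmap V t s v \<in> common_kernel X t"
proof -
  have vc: "v \<in> carrier (fibre V s)" using v by (simp add: common_kernel_def)
  have "snd b t (tmap V t s v) = \<zero>\<^bsub>K\<^esub>" if b: "b \<in> X" for b
  proof (cases "t \<in> support (fst b)")
    case True
    then show ?thesis
      using split_barD(6)[OF X[OF b] st True vc] v b by (simp add: common_kernel_def)
  next
    case False
    then show ?thesis using split_barD(4)[OF X[OF b] False] vc st by simp
  qed
  then show ?thesis using vc st by (simp add: common_kernel_def)
qed

context
  fixes X assumes X: "biorthogonal X"
begin

lemma coeff_closed: "\<lbrakk>b \<in> X; v \<in> carrier (fibre V t)\<rbrakk> \<Longrightarrow> snd b t v \<in> carrier K"
  using linear_functionalD(1)[OF split_barD(2)[OF biorthogonalD(1)[OF X]]] .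

lemma vector_closed: "b \<in> X \<Longrightarrow> fst b t \<in> carrier (fibre V t)"
  using split_barD(1)[OF biorthogonalD(1)[OF X]] .

lemma expansion_empty [simp]: "expansion {} t v = \<zero>\<^bsub>fibre V t\<^esub>"
  by (simp add: expansion_def)

lemma expansion_closed:
  assumes "F \<subseteq> X" "v \<in> carrier (fibre V t)"
  shows "expansion F t v \<in> carrier (fibre V t)"
  unfolding expansion_def
proof (intro fib.finsum_closed Pi_I fib.smult_closed)
  fix b assume "b \<in> F"
  then have "b \<in> X" using assms(1) by auto
  then show "snd b t v \<in> carrier K" "fst b t \<in> carrier (fibre V t)"
    using assms(2) by (simp_all add: coeff_closed vector_closed)
qed

lemma expansion_insert:
  assumes "finite F" "b \<notin> F" "insert b F \<subseteq> X" "v \<in> carrier (fibre V t)"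
  shows "expansion (insert b F) t v = snd b t v \<odot>\<^bsub>fibre V t\<^esub> fst b t \<oplus>\<^bsub>fibre V t\<^esub> expansion F t v"
proof -
  have "b \<in> X" "\<And>b. b \<in> F \<Longrightarrow> b \<in> X" using assms(3) by auto
  then show ?thesis
    unfolding expansion_def using assms
    by (intro fib.finsum_insert) (auto simp: coeff_closed vector_closed)
qed

lemma coeff_expansion:
  assumes b': "b' \<in> X" and v: "v \<in> carrier (fibre V t)" and "finite F" "F \<subseteq> X"
  shows "snd b' t (expansion F t v) = (if b' \<in> F then snd b' t v else \<zero>\<^bsub>K\<^esub>)"
  using assms(3,4)
proof (induction F rule: finite_induct)
  case empty
  show ?case using fib.linear_functional_zero[OF split_barD(2)[OF biorthogonalD(1)[OF X b']]] by simp
next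
  case (insert b F)
  then have b: "b \<in> X" "F \<subseteq> X" by auto
  note lin = linear_functionalD[OF split_barD(2)[OF biorthogonalD(1)[OF X b']]]
  have "snd b' t (expansion (insert b F) t v)
    = snd b t v \<otimes>\<^bsub>K\<^esub> snd b' t (fst b t) \<oplus>\<^bsub>K\<^esub> snd b' t (expansion F t v)"
    using insert b v by (simp add: expansion_insert lin coeff_closed vector_closed expansion_closed)
  also have "snd b t v \<otimes>\<^bsub>K\<^esub> snd b' t (fst b t) = (if b' = b then snd b t v else \<zero>\<^bsub>K\<^esub>)"
  proof (cases "b' = b")
    case True
    then show ?thesis
      using split_barD(3,4)[OF biorthogonalD(1)[OF X b']] v coeff_closed[OF b'] b'
      by (cases "t \<in> support (fst b)") (simp_all add: vector_closed)
  next
    case False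
    then show ?thesis using biorthogonalD(3)[OF X b' b(1)] coeff_closed[OF b(1) v] by simp
  qed
  finally show ?case
    using insert b coeff_closed[OF b(1) v] coeff_closed[OF b' v] by auto
qed

lemma expansion_vector:
  assumes b': "b' \<in> X" and "finite F" "F \<subseteq> X"
  shows "expansion F t (fst b' t) = (if b' \<in> F then fst b' t else \<zero>\<^bsub>fibre V t\<^esub>)"
  using assms(2,3)
proof (induction F rule: finite_induct)
  case (insert b F)
  then have b: "b \<in> X" by auto
  have "snd b t (fst b' t) \<odot>\<^bsub>fibre V t\<^esub> fst b t = (if b' = b then fst b t else \<zero>\<^bsub>fibre V t\<^esub>)"
  proof (cases "b' = b")
    case True
    then show ?thesis
      using split_barD(3)[OF biorthogonalD(1)[OF X b']] vector_closed[OF b'] coeff_closed[OF b' fib.M.zero_closed]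
      by (cases "t \<in> support (fst b)") (simp_all add: support_def)
  next
    case False
    then show ?thesis using biorthogonalD(3)[OF X b b'] vector_closed[OF b] by auto
  qed
  then show ?case
    using insert vector_closed[OF b'] by (auto simp: expansion_insert)
qed simp

lemma expansion_add:
  assumes "F \<subseteq> X" "v \<in> carrier (fibre V t)" "w \<in> carrier (fibre V t)"
  shows "expansion F t (v \<oplus>\<^bsub>fibre V t\<^esub> w) = expansion F t v \<oplus>\<^bsub>fibre V t\<^esub> expansion F t w"
proof -
  have F: "b \<in> X" if "b \<in> F" for b using assms(1) that by auto
  have "expansion F t (v \<oplus>\<^bsub>fibre V t\<^esub> w) = (\<Oplus>\<^bsub>fibre V t\<^esub>b\<in>F.
      snd b t v \<odot>\<^bsub>fibre V t\<^esub> fst b t \<oplus>\<^bsub>fibre V t\<^esub> snd b t w \<odot>\<^bsub>fibre V t\<^esub> fst b t)"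
    unfolding expansion_def using assms(2,3)
    by (intro fib.finsum_cong')
      (auto simp: F coeff_closed vector_closed fib.smult_l_distr
        linear_functionalD(2)[OF split_barD(2)[OF biorthogonalD(1)[OF X]]])
  also have "\<dots> = expansion F t v \<oplus>\<^bsub>fibre V t\<^esub> expansion F t w"
    unfolding expansion_def using assms(2,3)
    by (intro fib.finsum_addf) (auto simp: F coeff_closed vector_closed)
  finally show ?thesis .
qed

lemma expansion_smult:
  assumes "F \<subseteq> X" "c \<in> carrier K" "v \<in> carrier (fibre V t)"
  shows "expansion F t (c \<odot>\<^bsub>fibre V t\<^esub> v) = c \<odot>\<^bsub>fibre V t\<^esub> expansion F t v"
proof -
  have F: "b \<in> X" if "b \<in> F" for b using assms(1) that by auto
  have "c \<odot>\<^bsub>fibre V t\<^esub> expansion F t v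
    = (\<Oplus>\<^bsub>fibre V t\<^esub>b\<in>F. c \<odot>\<^bsub>fibre V t\<^esub> (snd b t v \<odot>\<^bsub>fibre V t\<^esub> fst b t))"
    unfolding expansion_def using assms(2,3)
    by (intro fib.finsum_smult) (auto simp: F coeff_closed vector_closed)
  also have "\<dots> = expansion F t (c \<odot>\<^bsub>fibre V t\<^esub> v)"
    unfolding expansion_def using assms(2,3)
    by (intro fib.finsum_cong')
      (auto simp: F coeff_closed vector_closed fib.smult_assoc1
        linear_functionalD(3)[OF split_barD(2)[OF biorthogonalD(1)[OF X]]])
  finally show ?thesis by simp
qed

lemma expansion_kernel:
  assumes "F \<subseteq> X" "v \<in> common_kernel X t"
  shows "expansion F t v = \<zero>\<^bsub>fibre V t\<^esub>"
  unfolding expansion_def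
proof (rule fib.M.add.finprod_one_eqI)
  fix b assume "b \<in> F"
  then show "snd b t v \<odot>\<^bsub>fibre V t\<^esub> fst b t = \<zero>\<^bsub>fibre V t\<^esub>"
    using assms vector_closed[of b t] by (auto simp: common_kernel_def)
qed

text \<open>
  Bars that do not live at \<open>t\<close> contribute nothing at \<open>t\<close>, so expansions
  at two indices can be compared over one finite set of bars.
\<close>

lemma expansion_bars_at:
  assumes "finite F" "F \<subseteq> X" "v \<in> carrier (fibre V t)"
  shows "expansion (bars_at F t) t v = expansion F t v"
  using assms(1,2)
proof (induction F rule: finite_induct)
  case empty
  show ?case by (simp add: bars_at_def)
next
  case (insert b F)
  then have b: "b \<in> X" "F \<subseteq> X" by auto
  show ?case
  proof (cases "t \<in> support (fst b)")
    case True
    then have "bars_at (insert b F) t = insert b (bars_at F t)" "bars_at F t \<subseteq> F"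
      by (auto simp: bars_at_def)
    moreover have "finite (bars_at F t)" "b \<notin> bars_at F t"
      using insert(1,2) by (auto simp: bars_at_def)
    ultimately show ?thesis
      using insert b assms(3) by (simp add: expansion_insert)
  next
    case False
    then have "bars_at (insert b F) t = bars_at F t" by (auto simp: bars_at_def)
    moreover have "snd b t v \<odot>\<^bsub>fibre V t\<^esub> fst b t = \<zero>\<^bsub>fibre V t\<^esub>"
      using False coeff_closed[OF b(1) assms(3)] by (simp add: support_def)
    ultimately show ?thesis
      using insert b assms(3) by (simp add: expansion_insert expansion_closed)
  qed
qed

lemma tmap_expansion:
  assumes st: "s \<le> t" and v: "v \<in> carrier (fibre V s)" and "finite F" "F \<subseteq> X"
  shows "tmap V t s (expansion F s v) = expansion F t (tmap V t s v)"
  using assms(3,4)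
proof (induction F rule: finite_induct)
  case (insert b F)
  then have b: "b \<in> X" "F \<subseteq> X" by auto
  note split = split_barD[OF biorthogonalD(1)[OF X b(1)]]
  have term_eq: "snd b s v \<odot>\<^bsub>fibre V t\<^esub> tmap V t s (fst b s)
    = snd b t (tmap V t s v) \<odot>\<^bsub>fibre V t\<^esub> fst b t"
  proof (cases "s \<in> support (fst b)")
    case s: True
    then have a: "tmap V t s (fst b s) = fst b t" using split(5)[OF st] by simp
    show ?thesis
    proof (cases "t \<in> support (fst b)")
      case True
      then show ?thesis using a split(6)[OF st True v] by simp
    next
      case False
      then have "fst b t = \<zero>\<^bsub>fibre V t\<^esub>" by (simp add: support_def)
      then show ?thesis using a st v coeff_closed[OF b(1)] by simp
    qed
  next
    case s: False
    then have z: "fst b s = \<zero>\<^bsub>fibre V s\<^esub>" "snd b s v = \<zero>\<^bsub>K\<^esub>"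
      using split(4)[OF s v] by (simp_all add: support_def)
    have "snd b t (tmap V t s v) = \<zero>\<^bsub>K\<^esub>"
      using split(6)[OF st _ v] split(4)[of t "tmap V t s v"] st v z(2)
      by (cases "t \<in> support (fst b)") simp_all
    then show ?thesis using z st vector_closed[OF b(1)] by simp
  qed
  then show ?case
    using insert b st v by (simp add: expansion_insert expansion_closed coeff_closed vector_closed)
qed (use st in simp)

end

end

context artinian_persistence_module
begin

text \<open>
  If infinitely many bars lived at \<open>t\<close>, the common kernels of more and more of their
  functionals would descend strictly: the vector of each bar lies in the kernels of all the others
  but not in its own.
\<close>

lemma finite_bars_at:
  assumes X: "biorthogonal X"
  shows "finite (bars_at X t)"
proof (rule ccontr)
  assume "infinite (bars_at X t)"
  then obtain g :: "nat \<Rightarrow> ('r, 'a, 'v) bar" where g: "inj g" "range g \<subseteq> bars_at X t"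
    using infinite_countable_subset by blast
  have gX: "g i \<in> X" "t \<in> support (fst (g i))" for i using g(2) by (auto simp: bars_at_def)
  let ?W = "\<lambda>n. common_kernel (g ` {..<n}) t"
  have "\<forall>W\<in>range ?W. submodule K W (fibre V t)"
  proof
    fix W assume "W \<in> range ?W"
    then obtain n where "W = ?W n" by (elim rangeE)
    moreover have "submodule K (?W n) (fibre V t)"
      using gX split_barD(2)[OF biorthogonalD(1)[OF X]] by (intro submodule_common_kernel) (elim imageE, simp)
    ultimately show "submodule K W (fibre V t)" by simp
  qed
  then have "\<exists>W\<in>range ?W. \<forall>W'\<in>range ?W. W' \<subseteq> W \<longrightarrow> W' = W"
    using artinian_fibre[unfolded fib.artinian_def, rule_format, of "range ?W"] by simp
  then obtain n where n: "\<And>m. ?W m \<subseteq> ?W n \<Longrightarrow> ?W m = ?W n"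
    unfolding bex_simps ball_simps by metis
  have "?W (Suc n) \<subseteq> ?W n" by (auto simp: common_kernel_def)
  then have eq: "?W (Suc n) = ?W n" by (rule n)
  have "snd (g i) t (fst (g n) t) = \<zero>\<^bsub>K\<^esub>" if "i < n" for i
    using biorthogonalD(3)[OF X gX(1) gX(1)] that injD[OF g(1), of i n] by fastforce
  then have "fst (g n) t \<in> ?W n"
    using split_barD(1)[OF biorthogonalD(1)[OF X gX(1)]] by (simp add: common_kernel_def)
  then have "fst (g n) t \<in> ?W (Suc n)" unfolding eq .
  then have "snd (g n) t (fst (g n) t) = \<zero>\<^bsub>K\<^esub>" by (simp add: common_kernel_def)
  moreover have "snd (g n) t (fst (g n) t) = \<one>\<^bsub>K\<^esub>"
    using split_barD(3)[OF biorthogonalD(1)[OF X gX(1)] gX(2)] .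
  ultimately show False by simp
qed

text \<open>
  The projection of \<open>V\<close> onto the common kernel along the summands given by
  \<open>X\<close>, a natural idempotent.
\<close>

definition residue :: "('r, 'a, 'v) bar set \<Rightarrow> 'r \<Rightarrow> 'v \<Rightarrow> 'v"
  where "residue X t v = v \<ominus>\<^bsub>fibre V t\<^esub> expansion (bars_at X t) t v"

context
  fixes X assumes X: "biorthogonal X"
begin

lemmas bars_at_facts = finite_bars_at[OF X] bars_at_subset

lemma residue_closed:
  assumes v: "v \<in> carrier (fibre V t)"
  shows "residue X t v \<in> carrier (fibre V t)"
  using v bars_at_facts by (simp add: residue_def expansion_closed[OF X])

lemma residue_in_common_kernel:
  assumes v: "v \<in> carrier (fibre V t)"
  shows "residue X t v \<in> common_kernel X t"
  unfolding common_kernel_def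
proof (intro CollectI conjI ballI residue_closed v)
  fix b assume b: "b \<in> X"
  note lin = split_barD(2)[OF biorthogonalD(1)[OF X b]]
  let ?e = "expansion (bars_at X t) t v"
  have e: "?e \<in> carrier (fibre V t)" using expansion_closed[OF X] v bars_at_facts by simp
  have "snd b t ?e = snd b t v"
    using coeff_expansion[OF X b v bars_at_facts(1,2)] b split_barD(4)[OF biorthogonalD(1)[OF X b] _ v]
    by (auto simp: bars_at_def)
  moreover have "v = residue X t v \<oplus>\<^bsub>fibre V t\<^esub> ?e"
    using v e by (simp add: residue_def a_minus_def fib.M.a_assoc fib.M.l_neg)
  then have "snd b t v = snd b t (residue X t v) \<oplus>\<^bsub>K\<^esub> snd b t ?e"
    using linear_functionalD(2)[OF lin residue_closed[OF v] e] by simp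
  ultimately show "snd b t (residue X t v) = \<zero>\<^bsub>K\<^esub>"
    using linear_functionalD(1)[OF lin] residue_closed[OF v] v fib.R.add.r_cancel_one' by metis
qed

lemma residue_common_kernel:
  assumes "v \<in> common_kernel X t"
  shows "residue X t v = v"
proof -
  have "v \<in> carrier (fibre V t)" using assms by (simp add: common_kernel_def)
  then show ?thesis
    using expansion_kernel[OF X bars_at_facts(2) assms] by (simp add: residue_def a_minus_def)
qed

lemma residue_vector:
  assumes "b \<in> X"
  shows "residue X t (fst b t) = \<zero>\<^bsub>fibre V t\<^esub>"
proof -
  have c: "fst b t \<in> carrier (fibre V t)" using vector_closed[OF X assms] .
  have "expansion (bars_at X t) t (fst b t) = fst b t"
    using expansion_vector[OF X assms bars_at_facts(1,2)] assms by (simp add: bars_at_def support_def)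
  then show ?thesis using fib.M.r_neg[OF c] by (simp add: residue_def a_minus_def)
qed

lemma residue_add:
  assumes v: "v \<in> carrier (fibre V t)" and w: "w \<in> carrier (fibre V t)"
  shows "residue X t (v \<oplus>\<^bsub>fibre V t\<^esub> w) = residue X t v \<oplus>\<^bsub>fibre V t\<^esub> residue X t w"
proof -
  let ?F = "bars_at X t"
  have e: "expansion ?F t v \<in> carrier (fibre V t)" "expansion ?F t w \<in> carrier (fibre V t)"
    using expansion_closed[OF X bars_at_facts(2)] v w by simp_all
  show ?thesis
    using expansion_add[OF X bars_at_facts(2) v w] v w e
    by (simp add: residue_def a_minus_def fib.M.minus_add fib.M.a_ac)
qed

lemma residue_smult:
  assumes c: "c \<in> carrier K" and v: "v \<in> carrier (fibre V t)"
  shows "residue X t (c \<odot>\<^bsub>fibre V t\<^esub> v) = c \<odot>\<^bsub>fibre V t\<^esub> residue X t v"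
  using expansion_smult[OF X bars_at_facts(2) c v] expansion_closed[OF X bars_at_facts(2) v] v c
  by (simp add: residue_def a_minus_def fib.smult_r_distr fib.smult_r_minus)

lemma tmap_residue:
  assumes st: "s \<le> t" and v: "v \<in> carrier (fibre V s)"
  shows "tmap V t s (residue X s v) = residue X t (tmap V t s v)"
proof -
  let ?F = "bars_at X s \<union> bars_at X t"
  have F: "finite ?F" "?F \<subseteq> X" using finite_bars_at[OF X] by (auto simp: bars_at_def)
  have "bars_at ?F s = bars_at X s" "bars_at ?F t = bars_at X t" by (auto simp: bars_at_def)
  then have "expansion (bars_at X s) s v = expansion ?F s v"
    "expansion (bars_at X t) t (tmap V t s v) = expansion ?F t (tmap V t s v)"
    using expansion_bars_at[OF X F] v st by (metis tmap_closed)+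
  then show ?thesis
    using tmap_expansion[OF X st v F] st v expansion_closed[OF X F(2) v]
    by (simp add: residue_def)
qed

text \<open>
  The common kernel is itself a persistence module with the descending chain condition; if it is
  nonzero, it has an interval summand. Composing the functionals of that summand with the natural
  projection onto the common kernel makes it a summand of \<open>V\<close> biorthogonal to
  \<open>X\<close>.
\<close>

lemma biorthogonal_extend:
  assumes "v \<in> common_kernel X t" "v \<noteq> \<zero>\<^bsub>fibre V t\<^esub>"
  obtains b where "b \<notin> X" "biorthogonal (insert b X)"
proof -
  let ?W = "restrict_pers V (common_kernel X)"
  note split = split_barD[OF biorthogonalD(1)[OF X]]
  have ker: "\<And>t. submodule K (common_kernel X t) (fibre V t)"
    by (intro submodule_common_kernel split)
  interpret W: artinian_persistence_module K ?W
    using ker tmap_common_kernel[OF biorthogonalD(1)[OF X]]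
    by (rule artinian_persistence_module_restrict_pers)
  obtain a f where af: "W.split_bar a f" "t \<in> W.support a"
    using W.exists_split_bar[of v t] assms by auto
  have supp: "W.support a = support a" by (simp add: W.support_def support_def)
  note W_split = W.split_barD[OF af(1), unfolded supp restrict_pers_simps, simplified]
  have kerD: "x \<in> carrier (fibre V s)" "b \<in> X \<Longrightarrow> snd b s x = \<zero>\<^bsub>K\<^esub>" if "x \<in> common_kernel X s" for x s b
    using that by (simp_all add: common_kernel_def)
  let ?g = "\<lambda>s x. f s (residue X s x)"
  note lin = linear_functionalD[OF W_split(2), simplified]
  have "linear_functional K (fibre V s) (?g s)" for s
    unfolding linear_functional_def
    using lin residue_in_common_kernel by (simp add: residue_add residue_smult)
  moreover have "?g s (a s) = \<one>\<^bsub>K\<^esub>" if "s \<in> support a" for s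
    using W_split(1,3) that residue_common_kernel by simp
  moreover have "?g s x = \<zero>\<^bsub>K\<^esub>" if "s \<notin> support a" "x \<in> carrier (fibre V s)" for s x
    using W_split(4) that residue_in_common_kernel by simp
  moreover have "?g s' (tmap V s' s x) = ?g s x"
    if "s \<le> s'" "s' \<in> support a" "x \<in> carrier (fibre V s)" for s s' x
    using W_split(6)[OF that(1,2) residue_in_common_kernel[OF that(3)]] tmap_residue[OF that(1,3)] by simp
  ultimately have bar: "split_bar a ?g"
    using W_split(1,5) kerD(1) unfolding split_bar_def support_def by simp
  show thesis
  proof (rule that)
    have "?g t (a t) = \<one>\<^bsub>K\<^esub>" using split_barD(3)[OF bar] af(2) supp by simp
    then show "(a, ?g) \<notin> X" using kerD(2)[OF W_split(1), of "(a, ?g)" t] by auto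
    have "?g s (fst b s) = \<zero>\<^bsub>K\<^esub>" if "b \<in> X" for b s
      using residue_vector[OF that] W.fib.linear_functional_zero[OF W.split_barD(2)[OF af(1)]] by simp
    moreover have "snd b s (a s) = \<zero>\<^bsub>K\<^esub>" if "b \<in> X" for b s
      using kerD(2)[OF W_split(1) that] .
    ultimately show "biorthogonal (insert (a, ?g) X)"
      using X bar af(2) supp unfolding biorthogonal_def by auto
  qed
qed

end

text \<open>
  Zorn's lemma gives a maximal biorthogonal family; by maximality nothing is left over for its
  common kernel.
\<close>

theorem exists_complete_biorthogonal:
  obtains X where "biorthogonal X" "\<And>t. common_kernel X t = {\<zero>\<^bsub>fibre V t\<^esub>}"
proof -
  have "\<exists>X\<in>Collect biorthogonal. \<forall>Y\<in>Collect biorthogonal. X \<subseteq> Y \<longrightarrow> Y = X"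
  proof (rule subset_Zorn')
    fix \<X> assume \<X>: "subset.chain (Collect biorthogonal) \<X>"
    have bi: "biorthogonal X" if "X \<in> \<X>" for X
      using subsetD[OF conjunct1[OF \<X>[unfolded subset_chain_def]] that] by (rule CollectD)
    have chain: "X \<subseteq> Y \<or> Y \<subseteq> X" if "X \<in> \<X>" "Y \<in> \<X>" for X Y
      using conjunct2[OF \<X>[unfolded subset_chain_def], rule_format, OF that] .
    have "snd b t (fst b' t) = \<zero>\<^bsub>K\<^esub>" if b: "b \<in> \<Union>\<X>" "b' \<in> \<Union>\<X>" "b \<noteq> b'" for b b' t
    proof -
      obtain Y where "Y \<in> \<X>" "b \<in> Y" "b' \<in> Y" 
      proof -
        obtain Y Y' where Y: "Y \<in> \<X>" "b \<in> Y" "Y' \<in> \<X>" "b' \<in> Y'"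
          using b(1,2) by (elim UnionE)
        show ?thesis
          using chain[OF Y(1,3)] that[OF Y(1,2) subsetD] that[OF Y(3) subsetD] Y by (elim disjE) metis+
      qed
      then show ?thesis using biorthogonalD(3)[OF bi] b(3) by simp
    qed
    moreover have "split_bar (fst b) (snd b) \<and> support (fst b) \<noteq> {}" if "b \<in> \<Union>\<X>" for b
      using that biorthogonalD(1,2)[OF bi] by (elim UnionE) simp
    ultimately show "\<Union>\<X> \<in> Collect biorthogonal"
      by (intro CollectI biorthogonal_def[THEN iffD2] conjI ballI impI allI) simp_all
  qed
  then obtain X where X: "biorthogonal X" and max: "\<And>Y. \<lbrakk>biorthogonal Y; X \<subseteq> Y\<rbrakk> \<Longrightarrow> Y = X"
    by (elim bexE) simp
  show thesis
  proof (rule that[OF X])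
    fix t
    have "\<zero>\<^bsub>fibre V t\<^esub> \<in> common_kernel X t"
      using fib.linear_functional_zero[OF split_barD(2)[OF biorthogonalD(1)[OF X]]]
      by (simp add: common_kernel_def)
    moreover have "common_kernel X t \<subseteq> {\<zero>\<^bsub>fibre V t\<^esub>}"
    proof (rule ccontr)
      assume "\<not> ?thesis"
      then obtain v where ker: "v \<in> common_kernel X t" and "v \<noteq> \<zero>\<^bsub>fibre V t\<^esub>" by blast
      then obtain b where "b \<notin> X" "biorthogonal (insert b X)"
        using biorthogonal_extend[OF X ker] by metis
      then show False using max[of "insert b X"] by auto
    qed
    ultimately show "common_kernel X t = {\<zero>\<^bsub>fibre V t\<^esub>}" by (simp add: set_eq_subset)
  qed
qed

end

section \<open>Coordinates with respect to a complete family\<close>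

lemma pers_isomorphicI:
  assumes "persistence_module K V" "persistence_module K W" and \<phi>: "pers_morphism K V W \<phi>"
    and bij: "\<And>t. bij_betw (\<phi> t) (carrier (fibre V t)) (carrier (fibre W t))"
  shows "pers_isomorphic K V W"
proof -
  interpret V: persistence_module K V by fact
  interpret W: persistence_module K W by fact
  define \<psi> where "\<psi> t = the_inv_into (carrier (fibre V t)) (\<phi> t)" for t
  have inj: "inj_on (\<phi> t) (carrier (fibre V t))" and surj: "\<phi> t ` carrier (fibre V t) = carrier (fibre W t)" for t
    using bij by (auto simp: bij_betw_def)
  have \<psi>_closed: "\<psi> t y \<in> carrier (fibre V t)" if "y \<in> carrier (fibre W t)" for t y
    unfolding \<psi>_def using the_inv_into_into[OF inj _ subset_refl, of y t] that surj by simp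
  have \<phi>\<psi>: "\<phi> t (\<psi> t y) = y" if "y \<in> carrier (fibre W t)" for t y
    unfolding \<psi>_def using f_the_inv_into_f[OF inj, of y t] that surj by simp
  have \<psi>\<phi>: "\<psi> t (\<phi> t x) = x" if "x \<in> carrier (fibre V t)" for t x
    unfolding \<psi>_def by (rule the_inv_into_f_f[OF inj that])
  have \<psi>_eqI: "\<psi> t y = x" if "x \<in> carrier (fibre V t)" "\<phi> t x = y" for t x y
    using \<psi>\<phi> that by auto
  have hom: "\<phi> t \<in> module_hom K (fibre V t) (fibre W t)" for t
    using \<phi> by (simp add: pers_morphism_def linear_map_def mod_hom_def mod_hom_axioms_def)
  note \<phi>_simps = module_hom_add[OF hom] module_hom_smult[OF hom]
  have "linear_map K (fibre W t) (fibre V t) (\<psi> t)" for t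
  proof -
    have "mod_hom_axioms K (fibre W t) (fibre V t) (\<psi> t)"
      unfolding mod_hom_axioms_def module_hom_def
      by (auto simp: \<psi>_closed \<phi>_simps \<phi>\<psi> intro!: \<psi>_eqI)
    then show ?thesis
      by (simp add: linear_map_def mod_hom_def V.fib.vectorspace_axioms W.fib.vectorspace_axioms
        V.fib.module_axioms W.fib.module_axioms)
  qed
  moreover have "\<psi> t (tmap W t s y) = tmap V t s (\<psi> s y)"
    if "s \<le> t" "y \<in> carrier (fibre W s)" for s t y
    using \<phi> that \<psi>_closed[OF that(2)] \<phi>\<psi>[OF that(2)]
    by (intro \<psi>_eqI) (simp_all add: pers_morphism_def)
  ultimately have "pers_morphism K W V \<psi>" by (simp add: pers_morphism_def)
  with \<phi> \<phi>\<psi> \<psi>\<phi> show ?thesis unfolding pers_isomorphic_def by blast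
qed

text \<open>
  By biorthogonality, adding a multiple of the vector of one bar changes only the coordinate of
  that bar. This gives the surjectivity of the coordinate map in the decomposition.
\<close>

lemma (in persistence_module) exists_vector_with_coeffs:
  assumes X: "biorthogonal X" and "finite F" "F \<subseteq> bars_at X t"
    and c: "\<And>b. b \<in> F \<Longrightarrow> c b \<in> carrier K"
  shows "\<exists>v\<in>carrier (fibre V t). \<forall>b\<in>X. snd b t v = (if b \<in> F then c b else \<zero>\<^bsub>K\<^esub>)"
  using assms(2-)
proof (induction F rule: finite_induct)
  case empty
  show ?case
    using fib.linear_functional_zero[OF split_barD(2)[OF biorthogonalD(1)[OF X]]]
    by (intro bexI[of _ "\<zero>\<^bsub>fibre V t\<^esub>"]) simp_all
next
  case (insert b F)
  then have b: "b \<in> X" "t \<in> support (fst b)" "c b \<in> carrier K" by (auto simp: bars_at_def)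
  from insert obtain v where v: "v \<in> carrier (fibre V t)"
    "\<forall>b\<in>X. snd b t v = (if b \<in> F then c b else \<zero>\<^bsub>K\<^esub>)" by auto
  let ?v = "v \<oplus>\<^bsub>fibre V t\<^esub> c b \<odot>\<^bsub>fibre V t\<^esub> fst b t"
  have "snd b' t ?v = (if b' \<in> insert b F then c b' else \<zero>\<^bsub>K\<^esub>)" if b': "b' \<in> X" for b'
  proof -
    note lin = linear_functionalD[OF split_barD(2)[OF biorthogonalD(1)[OF X b']]]
    have "snd b' t ?v = snd b' t v \<oplus>\<^bsub>K\<^esub> c b \<otimes>\<^bsub>K\<^esub> snd b' t (fst b t)"
      using v(1) b vector_closed[OF X b(1)] by (simp add: lin)
    then show ?thesis
      using v(2) b' b insert biorthogonalD(3)[OF X b' b(1)] split_barD(3)[OF biorthogonalD(1)[OF X b(1)] b(2)]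
      by (cases "b' = b") auto
  qed
  moreover have "?v \<in> carrier (fibre V t)" using v(1) b vector_closed[OF X b(1)] by simp
  ultimately show ?case by (intro bexI[of _ ?v] ballI)
qed

lemma interval_sum_simps:
  "carrier (fibre (pers_direct_sum J (\<lambda>j. interval_module K (I j))) t) =
    {f \<in> (\<Pi>\<^sub>E j\<in>J. if t \<in> I j then carrier K else {\<zero>\<^bsub>K\<^esub>}). finite {j \<in> J. f j \<noteq> \<zero>\<^bsub>K\<^esub>}}"
  "f \<oplus>\<^bsub>fibre (pers_direct_sum J (\<lambda>j. interval_module K (I j))) t\<^esub> g = (\<lambda>j\<in>J. f j \<oplus>\<^bsub>K\<^esub> g j)"
  "c \<odot>\<^bsub>fibre (pers_direct_sum J (\<lambda>j. interval_module K (I j))) t\<^esub> f = (\<lambda>j\<in>J. c \<otimes>\<^bsub>K\<^esub> f j)"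
  "tmap (pers_direct_sum J (\<lambda>j. interval_module K (I j))) t s f =
    (\<lambda>j\<in>J. if s \<in> I j \<and> t \<in> I j then f j else \<zero>\<^bsub>K\<^esub>)"
  by (simp_all add: pers_direct_sum_def direct_sum_mod_def interval_module_def)

text \<open>
  For a complete biorthogonal family, the coordinates \<open>f t v\<close> of a vector
  \<open>v\<close> with respect to all bars define the isomorphism onto the direct sum. Bars are
  indexed by their support together with a number that tells bars with the same support apart;
  such numbers exist because all bars with a common support live at one index, where there are
  only finitely many.
\<close>

theorem (in artinian_persistence_module) interval_decomposition:
  "\<exists>J :: ('r set \<times> nat) set. (\<forall>j\<in>J. order_interval (fst j)) \<and>
    pers_isomorphic K V (pers_direct_sum J (\<lambda>j. interval_module K (fst j)))"
proof -
  obtain X where X: "biorthogonal X" and complete: "\<And>t. common_kernel X t = {\<zero>\<^bsub>fibre V t\<^esub>}"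
    by (rule exists_complete_biorthogonal; blast)
  note split = split_barD[OF biorthogonalD(1)[OF X]]
  define same where "same b = {b' \<in> X. support (fst b') = support (fst b)}" for b :: "('r, 'a, 'v) bar"
  have countable_same: "countable (same b)" if b: "b \<in> X" for b
  proof -
    obtain t where "t \<in> support (fst b)" using biorthogonalD(2)[OF X b] by blast
    then have "same b \<subseteq> bars_at X t" by (auto simp: same_def bars_at_def)
    then show ?thesis using finite_bars_at[OF X] by (meson countable_finite finite_subset)
  qed
  define label where "label b = (support (fst b), to_nat_on (same b) b)" for b
  have "inj_on label X"
  proof (rule inj_onI)
    fix b b' assume *: "b \<in> X" "b' \<in> X" "label b = label b'"
    then have "same b = same b'" "b \<in> same b" "b' \<in> same b" by (simp_all add: label_def same_def)
    moreover from this * have "to_nat_on (same b) b = to_nat_on (same b) b'" by (simp add: label_def)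
    ultimately show "b = b'" using inj_on_to_nat_on[OF countable_same[OF *(1)]] by (simp add: inj_on_def)
  qed
  define J where "J = label ` X"
  define bar where "bar = the_inv_into X label"
  have bar_label: "bar (label b) = b" if "b \<in> X" for b
    unfolding bar_def by (rule the_inv_into_f_f[OF \<open>inj_on label X\<close> that])
  have bar: "bar j \<in> X" "support (fst (bar j)) = fst j" "label (bar j) = j" if "j \<in> J" for j
    using that bar_label by (auto simp: J_def label_def)
  let ?W = "pers_direct_sum J (\<lambda>j. interval_module K (fst j)) :: ('r, 'a, 'r set \<times> nat \<Rightarrow> 'a) pers_mod"
  have interval: "order_interval (fst j)" if "j \<in> J" for j
    using order_interval_support[OF biorthogonalD(1,2)[OF X bar(1)[OF that]]] bar(2)[OF that] by simp
  have W: "persistence_module K ?W"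
    by (intro persistence_module_pers_direct_sum persistence_module_interval_module interval fib.field_axioms)
  interpret W: persistence_module K ?W by (rule W)
  define \<phi> where "\<phi> t v = (\<lambda>j\<in>J. snd (bar j) t v)" for t v
  have lin: "linear_functional K (fibre V t) (snd (bar j) t)" if "j \<in> J" for t j
    using split(2)[OF bar(1)[OF that]] .
  have vanish: "snd (bar j) t v = \<zero>\<^bsub>K\<^esub>" if "j \<in> J" "t \<notin> fst j" "v \<in> carrier (fibre V t)" for t j v
    using split(4)[OF bar(1)[OF that(1)] _ that(3)] bar(2)[OF that(1)] that(2) by simp
  have \<phi>_closed: "\<phi> t v \<in> carrier (fibre ?W t)" if v: "v \<in> carrier (fibre V t)" for t v
  proof -
    have "{j \<in> J. \<phi> t v j \<noteq> \<zero>\<^bsub>K\<^esub>} \<subseteq> label ` bars_at X t"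
    proof (rule subsetI)
      fix j assume "j \<in> {j \<in> J. \<phi> t v j \<noteq> \<zero>\<^bsub>K\<^esub>}"
      then have j: "j \<in> J" "\<phi> t v j \<noteq> \<zero>\<^bsub>K\<^esub>" by simp_all
      then have "snd (bar j) t v \<noteq> \<zero>\<^bsub>K\<^esub>" by (simp add: \<phi>_def)
      then have "t \<in> fst j" using vanish[OF j(1) _ v] by metis
      then have "bar j \<in> bars_at X t" using bar(1,2)[OF j(1)] by (simp add: bars_at_def)
      then show "j \<in> label ` bars_at X t" by (rule rev_image_eqI) (simp add: bar(3)[OF j(1)])
    qed
    then have "finite {j \<in> J. \<phi> t v j \<noteq> \<zero>\<^bsub>K\<^esub>}"
      using finite_bars_at[OF X] by (meson finite_imageI finite_subset)
    moreover have "\<phi> t v \<in> (\<Pi>\<^sub>E j\<in>J. if t \<in> fst j then carrier K else {\<zero>\<^bsub>K\<^esub>})"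
      unfolding \<phi>_def
    proof (rule restrict_PiE_iff[THEN iffD2], rule ballI)
      fix j assume "j \<in> J"
      then show "snd (bar j) t v \<in> (if t \<in> fst j then carrier K else {\<zero>\<^bsub>K\<^esub>})"
        using linear_functionalD(1)[OF lin[of j t] v] vanish[OF _ _ v, of j] by simp
    qed
    ultimately show ?thesis unfolding interval_sum_simps by simp
  qed
  have "linear_map K (fibre V t) (fibre ?W t) (\<phi> t)" for t
  proof -
    have "mod_hom_axioms K (fibre V t) (fibre ?W t) (\<phi> t)"
      unfolding mod_hom_axioms_def module_hom_def
    proof (intro CollectI conjI allI impI)
      show "\<phi> t \<in> carrier (fibre V t) \<rightarrow> carrier (fibre ?W t)" using \<phi>_closed by simp
    qed (auto simp: interval_sum_simps \<phi>_def linear_functionalD(2,3)[OF lin] intro!: restrict_ext)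
    then show ?thesis
      by (simp add: linear_map_def mod_hom_def fib.vectorspace_axioms W.fib.vectorspace_axioms
        fib.module_axioms W.fib.module_axioms)
  qed
  moreover have "\<phi> t (tmap V t s v) = tmap ?W t s (\<phi> s v)"
    if st: "s \<le> t" and v: "v \<in> carrier (fibre V s)" for s t v
  proof -
    have "snd (bar j) t (tmap V t s v) = (if s \<in> fst j \<and> t \<in> fst j then snd (bar j) s v else \<zero>\<^bsub>K\<^esub>)"
      if j: "j \<in> J" for j
      using split(6)[OF bar(1)[OF j] st _ v] bar(2)[OF j] vanish[OF j _ v] vanish[OF j, of t "tmap V t s v"] st v
      by (cases "t \<in> fst j") auto
    then show ?thesis unfolding interval_sum_simps \<phi>_def by (auto intro!: restrict_ext)
  qed
  ultimately have morph: "pers_morphism K V ?W \<phi>" by (simp add: pers_morphism_def)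
  have "bij_betw (\<phi> t) (carrier (fibre V t)) (carrier (fibre ?W t))" for t
    unfolding bij_betw_def
  proof
    show "inj_on (\<phi> t) (carrier (fibre V t))"
    proof (rule inj_onI)
      fix v w assume v: "v \<in> carrier (fibre V t)" and w: "w \<in> carrier (fibre V t)" and eq: "\<phi> t v = \<phi> t w"
      have "snd b t (v \<ominus>\<^bsub>fibre V t\<^esub> w) = \<zero>\<^bsub>K\<^esub>" if b: "b \<in> X" for b
      proof -
        have "label b \<in> J" using b by (simp add: J_def)
        then have "snd b t v = snd b t w"
          using fun_cong[OF eq, of "label b"] bar_label[OF b] by (simp add: \<phi>_def)
        moreover have "v = (v \<ominus>\<^bsub>fibre V t\<^esub> w) \<oplus>\<^bsub>fibre V t\<^esub> w"
          using v w by (simp add: a_minus_def fib.M.a_assoc fib.M.l_neg)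
        then have "snd b t v = snd b t (v \<ominus>\<^bsub>fibre V t\<^esub> w) \<oplus>\<^bsub>K\<^esub> snd b t w"
          using linear_functionalD(2)[OF split(2)[OF b]] v w by (metis fib.M.minus_closed)
        ultimately show ?thesis
          using linear_functionalD(1)[OF split(2)[OF b]] v w fib.R.add.r_cancel_one' by (metis fib.M.minus_closed)
      qed
      then have "v \<ominus>\<^bsub>fibre V t\<^esub> w \<in> common_kernel X t" using v w by (simp add: common_kernel_def)
      then have "v \<ominus>\<^bsub>fibre V t\<^esub> w = \<zero>\<^bsub>fibre V t\<^esub>" unfolding complete by simp
      then show "v = w" using v w by simp
    qed
    show "\<phi> t ` carrier (fibre V t) = carrier (fibre ?W t)"
    proof (intro equalityI image_subsetI subsetI \<phi>_closed)
      fix y assume y: "y \<in> carrier (fibre ?W t)"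
      then have yJ: "y j \<in> (if t \<in> fst j then carrier K else {\<zero>\<^bsub>K\<^esub>})" if "j \<in> J" for j
        using PiE_mem[OF _ that, of y "\<lambda>j. if t \<in> fst j then carrier K else {\<zero>\<^bsub>K\<^esub>}"]
        unfolding interval_sum_simps by simp
      have fin: "finite {j \<in> J. y j \<noteq> \<zero>\<^bsub>K\<^esub>}" and y_ext: "y \<in> extensional J"
        using y unfolding interval_sum_simps by (auto simp: PiE_def)
      let ?F = "bar ` {j \<in> J. y j \<noteq> \<zero>\<^bsub>K\<^esub>}"
      have "?F \<subseteq> bars_at X t"
      proof (rule image_subsetI)
        fix j assume j: "j \<in> {j \<in> J. y j \<noteq> \<zero>\<^bsub>K\<^esub>}"
        then have "t \<in> fst j" using yJ[of j] by (cases "t \<in> fst j") auto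
        then show "bar j \<in> bars_at X t" using bar(1,2)[of j] j by (simp add: bars_at_def)
      qed
      moreover have "y (label b) \<in> carrier K" if b: "b \<in> ?F" for b
      proof -
        obtain j where "j \<in> J" "b = bar j" using b by auto
        then show ?thesis using yJ[of j] bar(3)[of j] by (simp split: if_splits)
      qed
      ultimately have "\<exists>v\<in>carrier (fibre V t).
          \<forall>b\<in>X. snd b t v = (if b \<in> ?F then y (label b) else \<zero>\<^bsub>K\<^esub>)"
        by (intro exists_vector_with_coeffs[OF X finite_imageI[OF fin]])
      then obtain v where v: "v \<in> carrier (fibre V t)"
        and coeffs: "\<forall>b\<in>X. snd b t v = (if b \<in> ?F then y (label b) else \<zero>\<^bsub>K\<^esub>)"
        by (elim bexE)
      have "\<phi> t v j = y j" for j
      proof (cases "j \<in> J")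
        case True
        have "bar j \<in> ?F \<longleftrightarrow> y j \<noteq> \<zero>\<^bsub>K\<^esub>"
        proof
          assume "bar j \<in> ?F"
          then obtain i where i: "i \<in> J" "y i \<noteq> \<zero>\<^bsub>K\<^esub>" "bar j = bar i" by auto
          have "i = j" using bar(3)[OF True] unfolding i(3) bar(3)[OF i(1)] .
          with i(2) show "y j \<noteq> \<zero>\<^bsub>K\<^esub>" by simp
        qed (use True in simp)
        then have "snd (bar j) t v = (if y j \<noteq> \<zero>\<^bsub>K\<^esub> then y j else \<zero>\<^bsub>K\<^esub>)"
          using coeffs[rule_format, OF bar(1)[OF True]] by (simp only: bar(3)[OF True])
        then show ?thesis using True by (simp add: \<phi>_def)
      next
        case False
        then show ?thesis using extensional_arb[OF y_ext False] by (simp add: \<phi>_def)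
      qed
      then have "y = \<phi> t v" by (rule ext[OF sym])
      with v show "y \<in> \<phi> t ` carrier (fibre V t)" by (rule rev_image_eqI)
    qed
  qed
  with persistence_module_axioms W morph have "pers_isomorphic K V ?W" by (rule pers_isomorphicI)
  with interval show ?thesis by (intro exI[of _ J] conjI ballI)
qed

theorem theorem1p1:
  fixes K :: "('a, 'm) ring_scheme"
    and V :: "('r::linorder_topology, 'a, 'v) pers_mod"
  assumes "field K"
    and "\<exists>D :: 'r set. countable D \<and> closure D = UNIV"
    and "pfd_persistence_module K V"
  shows "\<exists>(J :: ('r set \<times> nat) set) I.
    (\<forall>j\<in>J. order_interval (I j)) \<and>
    pers_isomorphic K V (pers_direct_sum J (\<lambda>j. interval_module K (I j)))"
proof -
  interpret pfd_persistence_module K V by fact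
  interpret artinian_persistence_module K V by (rule pfd_imp_artinian)
  show ?thesis using interval_decomposition by blast
qed

end
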